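(* Let $n\ge 2$, let $\mathfrak{t}^*$ be the real vector space with basis $x_1,\dots,x_n$, and let $W$ be the group of signed permutations: pairs $(u,\epsilon)$ with $u\in S_n$, $\epsilon\in\{\pm1\}^n$, acting linearly on $\mathfrak{t}^*$ (and hence on $\mathbb{S}(\mathfrak{t}^* )=\mathbb{R}[x_1,\dots,x_n]$) by $(u,\epsilon)\cdot x_k=\epsilon_k x_{u(k)}$ (this is the Weyl group of type $B_n$). Let $\Delta^+=\{x_i:1\le i\le n\}\cup\{x_i\pm x_j:1\le i<j\le n\}$ and let $H_\alpha^*(W)$ be the ring of maps $f\colon W\to\mathbb{R}[x_1,\dots,x_n]$ with $f(ws_\beta)-f(w)\in (w\beta)\,\mathbb{R}[x_1,\dots,x_n]$ for all $w\in W$, $\beta\in\Delta^+$, where $s_\beta\in W$ is the orthogonal reflection in $\beta$. For $I=[i_1,\dots,i_n]$ let $c_I\colon W\to\mathbb{R}[x_1,\dots,x_n]$, $c_I((u,\epsilon))=(\epsilon_1x_{u(1)})^{i_1}\cdots(\epsilon_nx_{u(n)})^{i_n}$, and let $$\mathcal{B}_n=\{[i_1,\dots,i_n]:0\le i_k\le 2n-2k+1\ \text{for }k=1,\dots,n\}.$$ Then $\{c_I:I\in\mathcal{B}_n\}$ is a basis of the $\mathbb{R}[x_1,\dots,x_n]$-module $H_\alpha^*(W)$ consisting of $W$-invariant classes.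
   Context: $W$ acts on $H_\alpha^*(W)$ by $(w\cdot f)(v)=w^{-1}\cdot f(wv)$; a class is $W$-invariant if fixed by all $w\in W$. *)

theory Defs
  imports
    Complex_Main
    "HOL-Library.Poly_Mapping"
    "HOL-Combinatorics.Permutations"
    "HOL-Algebra.Ideal"
    "Jordan_Normal_Form.Missing_VectorSpace"
begin

section \<open>The polynomial ring\<close>

text \<open>
  Real polynomials in countably many indeterminates, as finitely supported maps from
  exponent vectors to coefficients. The ring in the indeterminates indexed by \<open>1, \<dots>, n\<close>
  is the subring \<open>poly_ring n\<close>.
\<close>

type_synonym rpoly = "(nat \<Rightarrow>\<^sub>0 nat) \<Rightarrow>\<^sub>0 real"

definition indet :: "nat \<Rightarrow> rpoly"
  where "indet k = Poly_Mapping.single (Poly_Mapping.single k 1) 1"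

definition const_poly :: "real \<Rightarrow> rpoly"
  where "const_poly a = Poly_Mapping.single 0 a"

definition poly_ring :: "nat \<Rightarrow> rpoly ring"
  where "poly_ring n =
    \<lparr>carrier = {p. \<forall>m\<in>Poly_Mapping.keys p. Poly_Mapping.keys m \<subseteq> {1..n}},
     mult = (*), one = 1, zero = 0, add = (+)\<rparr>"

section \<open>Signed permutations\<close>

text \<open>
  Both components of a signed permutation are total functions on \<^typ>\<open>nat\<close> that are trivial
  outside \<open>{1..n}\<close>, so that distinct pairs are distinct group elements. The multiplication is
  the one for which \<open>act\<close> below is a left action: \<open>(u, \<epsilon>) (v, \<delta>)\<close> sends \<open>x\<^sub>k\<close>
  to \<open>(u, \<epsilon>) \<cdot> \<delta>\<^sub>k x\<^sub>v\<^sub>(\<^sub>k\<^sub>)\<close>.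
\<close>

type_synonym signed_perm = "(nat \<Rightarrow> nat) \<times> (nat \<Rightarrow> int)"

definition weyl_B :: "nat \<Rightarrow> signed_perm monoid"
  where "weyl_B n =
    \<lparr>carrier = {(u, \<epsilon>). u permutes {1..n} \<and> (\<forall>k\<in>{1..n}. \<epsilon> k \<in> {1, -1}) \<and> (\<forall>k. k \<notin> {1..n} \<longrightarrow> \<epsilon> k = 1)},
     mult = (\<lambda>(u, \<epsilon>) (v, \<delta>). (u \<circ> v, \<lambda>k. \<delta> k * \<epsilon> (v k))),
     one = (id, \<lambda>_. 1)\<rparr>"

definition act_var :: "signed_perm \<Rightarrow> nat \<Rightarrow> rpoly"
  where "act_var w k = of_int (snd w k) * indet (fst w k)"

definition act :: "signed_perm \<Rightarrow> rpoly \<Rightarrow> rpoly"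
  where "act w p = (\<Sum>m\<in>Poly_Mapping.keys p. const_poly (Poly_Mapping.lookup p m) *
    (\<Prod>k\<in>Poly_Mapping.keys m. act_var w k ^ Poly_Mapping.lookup m k))"

section \<open>Roots and reflections\<close>

definition linear_forms :: "nat \<Rightarrow> rpoly set"
  where "linear_forms n = {\<Sum>k=1..n. const_poly (a k) * indet k | a. True}"

definition pos_roots :: "nat \<Rightarrow> rpoly set"
  where "pos_roots n = {indet i | i. 1 \<le> i \<and> i \<le> n}
    \<union> {indet i + indet j | i j. 1 \<le> i \<and> i < j \<and> j \<le> n}
    \<union> {indet i - indet j | i j. 1 \<le> i \<and> i < j \<and> j \<le> n}"

text \<open>The inner product on linear forms for which \<open>x\<^sub>1, \<dots>, x\<^sub>n\<close> is orthonormal.\<close>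

definition form_inner :: "nat \<Rightarrow> rpoly \<Rightarrow> rpoly \<Rightarrow> real"
  where "form_inner n p q = (\<Sum>k=1..n. Poly_Mapping.lookup p (Poly_Mapping.single k 1) *
    Poly_Mapping.lookup q (Poly_Mapping.single k 1))"

definition orth_reflection :: "nat \<Rightarrow> rpoly \<Rightarrow> rpoly \<Rightarrow> rpoly"
  where "orth_reflection n \<beta> p = p - const_poly (2 * form_inner n p \<beta> / form_inner n \<beta> \<beta>) * \<beta>"

definition reflection_elt :: "nat \<Rightarrow> rpoly \<Rightarrow> signed_perm"
  where "reflection_elt n \<beta> =
    (THE s. s \<in> carrier (weyl_B n) \<and> (\<forall>p\<in>linear_forms n. act s p = orth_reflection n \<beta> p))"

section \<open>The ring \<open>H\<^sub>\<alpha>\<^sup>*(W)\<close>\<close>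

text \<open>
  Maps on \<open>W\<close> are extensional functions on the carrier; all operations are pointwise.
\<close>

definition H_alpha :: "nat \<Rightarrow> (rpoly, signed_perm \<Rightarrow> rpoly) module"
  where "H_alpha n =
    \<lparr>carrier = {f \<in> carrier (weyl_B n) \<rightarrow>\<^sub>E carrier (poly_ring n).
       \<forall>w\<in>carrier (weyl_B n). \<forall>\<beta>\<in>pos_roots n.
         f (w \<otimes>\<^bsub>weyl_B n\<^esub> reflection_elt n \<beta>) - f w \<in> PIdl\<^bsub>poly_ring n\<^esub> (act w \<beta>)},
     mult = (\<lambda>f g. \<lambda>w\<in>carrier (weyl_B n). f w * g w),
     one = (\<lambda>w\<in>carrier (weyl_B n). 1),
     zero = (\<lambda>w\<in>carrier (weyl_B n). 0),
     add = (\<lambda>f g. \<lambda>w\<in>carrier (weyl_B n). f w + g w),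
     smult = (\<lambda>p f. \<lambda>w\<in>carrier (weyl_B n). p * f w)\<rparr>"

definition act_class :: "nat \<Rightarrow> signed_perm \<Rightarrow> (signed_perm \<Rightarrow> rpoly) \<Rightarrow> signed_perm \<Rightarrow> rpoly"
  where "act_class n w f =
    (\<lambda>v\<in>carrier (weyl_B n). act (inv\<^bsub>weyl_B n\<^esub> w) (f (w \<otimes>\<^bsub>weyl_B n\<^esub> v)))"

definition W_invariant :: "nat \<Rightarrow> (signed_perm \<Rightarrow> rpoly) \<Rightarrow> bool"
  where "W_invariant n f \<longleftrightarrow> (\<forall>w\<in>carrier (weyl_B n). act_class n w f = f)"

text \<open>The list \<open>I = [i\<^sub>1, \<dots>, i\<^sub>n]\<close> is indexed from \<open>0\<close>, whence \<open>I ! (k - 1)\<close> for \<open>i\<^sub>k\<close>.\<close>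

definition c_class :: "nat \<Rightarrow> nat list \<Rightarrow> signed_perm \<Rightarrow> rpoly"
  where "c_class n I =
    (\<lambda>(u, \<epsilon>)\<in>carrier (weyl_B n). \<Prod>k=1..n. (of_int (\<epsilon> k) * indet (u k)) ^ (I ! (k - 1)))"

definition index_set :: "nat \<Rightarrow> nat list set"
  where "index_set n = {I. length I = n \<and> (\<forall>k\<in>{1..n}. I ! (k - 1) \<le> 2 * n - 2 * k + 1)}"

section \<open>Bases of modules\<close>

text \<open>The library defines bases for vector spaces only; this is the same definition for modules.\<close>

definition module_basis :: "('a, 'r) ring_scheme \<Rightarrow> ('a, 'c, 'm) module_scheme \<Rightarrow> 'c set \<Rightarrow> bool"
  where "module_basis R M A \<longleftrightarrow> Module.module R M \<and>
    \<not> module.lin_dep R M A \<and> module.span R M A = carrier M \<and> A \<subseteq> carrier M"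

section \<open>Well-definedness\<close>

text \<open>
  \<^const>\<open>weyl_B\<close> is a group acting on the indeterminates, the description in
  \<^const>\<open>reflection_elt\<close> is satisfied by exactly one element, and \<^const>\<open>H_alpha\<close> is an algebra.
\<close>

lemma group_weyl_B: "group (weyl_B n)"
proof (rule groupI)
  fix x y assume "x \<in> carrier (weyl_B n)" "y \<in> carrier (weyl_B n)"
  then obtain u e v d where [simp]: "x = (u,e)" "y = (v,d)"
    and h: "u permutes {1..n}" "v permutes {1..n}"
      "\<And>k. k \<in> {1..n} \<Longrightarrow> e k = 1 \<or> e k = -1" "\<And>k. k \<in> {1..n} \<Longrightarrow> d k = 1 \<or> d k = -1"
      "\<And>k. k \<notin> {1..n} \<Longrightarrow> e k = 1" "\<And>k. k \<notin> {1..n} \<Longrightarrow> d k = 1"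
    by (cases x; cases y) (auto simp: weyl_B_def)
  have 1: "d k * e (v k) = 1 \<or> d k * e (v k) = -1" if "k \<in> {1..n}" for k
    using h(3)[of "v k"] h(4)[of k] that permutes_in_image[OF h(2), of k] by auto
  have 2: "d k * e (v k) = 1" if "k \<notin> {1..n}" for k
    using h(5)[of "v k"] h(6)[of k] that permutes_in_image[OF h(2), of k] by auto
  show "x \<otimes>\<^bsub>weyl_B n\<^esub> y \<in> carrier (weyl_B n)"
    using permutes_compose[OF h(2,1)] 1 2 by (simp add: weyl_B_def)
next
  show "\<one>\<^bsub>weyl_B n\<^esub> \<in> carrier (weyl_B n)"
    by (simp add: weyl_B_def permutes_id)
next
  fix x y z assume "x \<in> carrier (weyl_B n)" "y \<in> carrier (weyl_B n)" "z \<in> carrier (weyl_B n)"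
  show "x \<otimes>\<^bsub>weyl_B n\<^esub> y \<otimes>\<^bsub>weyl_B n\<^esub> z = x \<otimes>\<^bsub>weyl_B n\<^esub> (y \<otimes>\<^bsub>weyl_B n\<^esub> z)"
    by (cases x; cases y; cases z) (auto simp: weyl_B_def)
next
  fix x assume "x \<in> carrier (weyl_B n)"
  show "\<one>\<^bsub>weyl_B n\<^esub> \<otimes>\<^bsub>weyl_B n\<^esub> x = x"
    by (cases x) (auto simp: weyl_B_def)
next
  fix x assume "x \<in> carrier (weyl_B n)"
  then obtain u e where [simp]: "x = (u,e)"
    and h: "u permutes {1..n}"
      "\<And>k. k \<in> {1..n} \<Longrightarrow> e k = 1 \<or> e k = -1" "\<And>k. k \<notin> {1..n} \<Longrightarrow> e k = 1"
    by (cases x) (auto simp: weyl_B_def)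
  define v where "v = inv_into UNIV u"
  have v: "v permutes {1..n}" "v \<circ> u = id"
    using permutes_inv[OF h(1)] permutes_inv_o[OF h(1)] by (simp_all add: v_def)
  have 1: "e (v k) = 1 \<or> e (v k) = -1" if "k \<in> {1..n}" for k
    using h(2)[of "v k"] that permutes_in_image[OF v(1), of k] by auto
  have 2: "e (v k) = 1" if "k \<notin> {1..n}" for k
    using h(3)[of "v k"] that permutes_in_image[OF v(1), of k] by auto
  have 3: "e k * e k = 1" for k using h(2,3)[of k] by (cases "k \<in> {1..n}") auto
  have 4: "v (u k) = k" for k using v(2) by (metis comp_apply id_apply)
  show "\<exists>y\<in>carrier (weyl_B n). y \<otimes>\<^bsub>weyl_B n\<^esub> x = \<one>\<^bsub>weyl_B n\<^esub>"
    by (rule bexI[of _ "(v, \<lambda>k. e (v k))"]) (use v 1 2 3 4 in \<open>auto simp: weyl_B_def\<close>)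
qed

lemma poly_ring_carrier_alt:
  "p \<in> carrier (poly_ring n) \<longleftrightarrow> (\<forall>m\<in>Poly_Mapping.keys p. Poly_Mapping.keys m \<subseteq> {1..n})"
  by (simp add: poly_ring_def)

lemma poly_ring_closed:
  "0 \<in> carrier (poly_ring n)" "1 \<in> carrier (poly_ring n)"
  "p \<in> carrier (poly_ring n) \<Longrightarrow> - p \<in> carrier (poly_ring n)"
  "p \<in> carrier (poly_ring n) \<Longrightarrow> q \<in> carrier (poly_ring n) \<Longrightarrow> p + q \<in> carrier (poly_ring n)"
  "p \<in> carrier (poly_ring n) \<Longrightarrow> q \<in> carrier (poly_ring n) \<Longrightarrow> p * q \<in> carrier (poly_ring n)"
proof -
  show "0 \<in> carrier (poly_ring n)" "1 \<in> carrier (poly_ring n)"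
    by (simp_all add: poly_ring_carrier_alt)
  show "p \<in> carrier (poly_ring n) \<Longrightarrow> - p \<in> carrier (poly_ring n)"
    by (auto simp: poly_ring_carrier_alt in_keys_iff)
  show "p \<in> carrier (poly_ring n) \<Longrightarrow> q \<in> carrier (poly_ring n) \<Longrightarrow> p + q \<in> carrier (poly_ring n)"
    using Poly_Mapping.keys_add[of p q] unfolding poly_ring_carrier_alt by blast
  show "p * q \<in> carrier (poly_ring n)"
    if "p \<in> carrier (poly_ring n)" "q \<in> carrier (poly_ring n)"
    unfolding poly_ring_carrier_alt
  proof
    fix m assume "m \<in> Poly_Mapping.keys (p * q)"
    then obtain a b where "m = a + b" "a \<in> Poly_Mapping.keys p" "b \<in> Poly_Mapping.keys q"
      using Poly_Mapping.keys_mult[of p q] by blast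
    then show "Poly_Mapping.keys m \<subseteq> {1..n}"
      using that Poly_Mapping.keys_add[of a b] unfolding poly_ring_carrier_alt by blast
  qed
qed

lemma poly_ring_ops:
  "add (poly_ring n) = (+)" "mult (poly_ring n) = (*)" "zero (poly_ring n) = 0" "one (poly_ring n) = 1"
  by (simp_all add: poly_ring_def)

lemma cring_poly_ring: "cring (poly_ring n)"
proof (rule cringI)
  show "abelian_group (poly_ring n)"
  proof (rule abelian_groupI)
    fix x assume "x \<in> carrier (poly_ring n)"
    then show "\<exists>y\<in>carrier (poly_ring n). y \<oplus>\<^bsub>poly_ring n\<^esub> x = \<zero>\<^bsub>poly_ring n\<^esub>"
      by (intro bexI[of _ "- x"]) (simp_all add: poly_ring_ops poly_ring_closed)
  qed (simp_all add: poly_ring_ops poly_ring_closed ac_simps)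
  show "comm_monoid (poly_ring n)"
    by (rule comm_monoidI) (simp_all add: poly_ring_ops poly_ring_closed ac_simps)
qed (simp add: poly_ring_ops algebra_simps)

lemma act_add: "act w (p + q) = act w p + act w q"
  unfolding act_def
  by (rule setsum_keys_plus_distrib) (simp_all add: const_poly_def single_add algebra_simps)

lemma act_single: "act w (Poly_Mapping.single m a) =
  const_poly a * (\<Prod>k\<in>Poly_Mapping.keys m. act_var w k ^ Poly_Mapping.lookup m k)"
  by (auto simp: act_def const_poly_def)

lemma act_sum: "act w (sum f A) = (\<Sum>a\<in>A. act w (f a))"
  by (induction A rule: infinite_finite_induct) (simp_all add: act_add, simp_all add: act_def)

lemma const_indet: "const_poly a * indet k = Poly_Mapping.single (Poly_Mapping.single k 1) a"
  by (simp add: const_poly_def indet_def mult_single)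

lemma act_const_indet: "act w (const_poly a * indet k) = const_poly a * act_var w k"
  unfolding const_indet act_single by simp

lemma act_indet: "act w (indet k) = act_var w k"
  using act_const_indet[of w 1 k] by (simp add: const_poly_def)

lemma single_1_inj: "Poly_Mapping.single i (1::nat) = Poly_Mapping.single k 1 \<longleftrightarrow> i = k"
  by (metis lookup_single_eq lookup_single_not_eq zero_neq_one)

lemma lookup_const_indet:
  "Poly_Mapping.lookup (const_poly a * indet i) (Poly_Mapping.single k 1) = (if i = k then a else 0)"
  unfolding const_indet by (simp only: lookup_single when_def single_1_inj)

lemma lookup_indet:
  "Poly_Mapping.lookup (indet i) (Poly_Mapping.single k 1) = (if i = k then 1 else 0)"
  unfolding indet_def by (simp only: lookup_single when_def single_1_inj)

lemma const_poly_simps: "const_poly (a + b) = const_poly a + const_poly b"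
  "const_poly (a * b) = const_poly a * const_poly b" "const_poly 0 = 0" "const_poly 1 = 1"
  "const_poly (- a) = - const_poly a"
  "const_poly (of_int z) = of_int z"
  by (simp_all add: const_poly_def single_add mult_single single_uminus)

lemma const_poly_sum: "const_poly (sum f A) = (\<Sum>a\<in>A. const_poly (f a))"
  by (induction A rule: infinite_finite_induct) (simp_all add: const_poly_simps)

lemma form_inner_sum: "form_inner n (\<Sum>k\<in>A. const_poly (a k) * indet k) q =
   (\<Sum>k\<in>A. a k * form_inner n (indet k) q)" if "finite A"
  unfolding form_inner_def lookup_sum lookup_const_indet lookup_indet sum_distrib_left sum_distrib_right
  by (subst sum.swap) (auto intro!: sum.cong)

lemma reflection_reduce:
  assumes "\<And>k. k \<in> {1..n} \<Longrightarrow> act_var s k = orth_reflection n b (indet k)" "p \<in> linear_forms n"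
  shows "act s p = orth_reflection n b p"
proof -
  obtain a where p: "p = (\<Sum>k=1..n. const_poly (a k) * indet k)"
    using assms(2) by (auto simp: linear_forms_def)
  have "act s p = (\<Sum>k=1..n. const_poly (a k) * act_var s k)"
    unfolding p act_sum act_const_indet ..
  also have "\<dots> = (\<Sum>k=1..n. const_poly (a k) * orth_reflection n b (indet k))"
    using assms(1) by simp
  also have "\<dots> = p - (\<Sum>k=1..n. const_poly (a k * (2 * form_inner n (indet k) b / form_inner n b b))) * b"
    unfolding orth_reflection_def p right_diff_distrib sum_subtractf sum_distrib_right const_poly_simps
    by (simp add: mult.assoc)
  also have "(\<Sum>k=1..n. const_poly (a k * (2 * form_inner n (indet k) b / form_inner n b b))) =
     const_poly (\<Sum>k=1..n. a k * (2 * form_inner n (indet k) b / form_inner n b b))"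
    by (rule const_poly_sum[symmetric])
  also have "(\<Sum>k=1..n. a k * (2 * form_inner n (indet k) b / form_inner n b b)) = 2 * form_inner n p b / form_inner n b b"
    unfolding p form_inner_sum[OF finite_atLeastAtMost] sum_distrib_left sum_divide_distrib
    by (simp add: algebra_simps)
  finally show ?thesis by (simp add: orth_reflection_def)
qed

lemma form_inner_indet: "i \<in> {1..n} \<Longrightarrow> form_inner n (indet k) (indet i) = (if k = i then 1 else 0)"
  unfolding form_inner_def lookup_indet by (auto intro!: sum.neutral simp: if_distrib[of "\<lambda>x. x * _"] cong: if_cong)

lemma form_inner_add: "form_inner n p (q + r) = form_inner n p q + form_inner n p r"
  "form_inner n (q + r) p = form_inner n q p + form_inner n r p"
  "form_inner n p (q - r) = form_inner n p q - form_inner n p r"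
  "form_inner n (q - r) p = form_inner n q p - form_inner n r p"
  by (simp_all add: form_inner_def lookup_add lookup_minus algebra_simps sum.distrib sum_subtractf)

lemma act_var_inj:
  assumes "a = 1 \<or> a = (-1::int)" "b = 1 \<or> b = (-1::int)" "of_int a * indet i = of_int b * indet j"
  shows "a = b \<and> i = j"
proof -
  have "Poly_Mapping.lookup (const_poly (of_int a) * indet i) (Poly_Mapping.single k 1) =
        Poly_Mapping.lookup (const_poly (of_int b) * indet j) (Poly_Mapping.single k 1)" for k
    using assms(3) by (simp only: const_poly_simps)
  from this[of i] show ?thesis using assms(1,2) unfolding lookup_const_indet by (auto split: if_splits)
qed

lemma reflection_ex1:
  assumes "\<beta> \<in> pos_roots n"
  shows "\<exists>!s. s \<in> carrier (weyl_B n) \<and> (\<forall>p\<in>linear_forms n. act s p = orth_reflection n \<beta> p)"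
proof (rule ex_ex1I)
  have "\<exists>s\<in>carrier (weyl_B n). \<forall>k\<in>{1..n}. act_var s k = orth_reflection n \<beta> (indet k)"
    using assms unfolding pos_roots_def
  proof (elim UnE CollectE exE conjE)
    fix i assume [simp]: "\<beta> = indet i" and i: "1 \<le> i" "i \<le> n"
    show ?thesis
      by (rule bexI[of _ "(id, \<lambda>k. if k = i then -1 else 1)"])
        (use i in \<open>auto simp: weyl_B_def permutes_id act_var_def orth_reflection_def form_inner_indet const_poly_simps const_poly_def\<close>)
  next
    fix i j assume [simp]: "\<beta> = indet i + indet j" and i: "1 \<le> i" "i < j" "j \<le> n"
    show ?thesis
      by (rule bexI[of _ "(transpose i j, \<lambda>k. if k = i \<or> k = j then -1 else 1)"])
        (use i in \<open>auto simp: weyl_B_def permutes_swap_id act_var_def orth_reflection_def form_inner_indet form_inner_add transpose_def const_poly_simps\<close>)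
  next
    fix i j assume [simp]: "\<beta> = indet i - indet j" and i: "1 \<le> i" "i < j" "j \<le> n"
    show ?thesis
      by (rule bexI[of _ "(transpose i j, \<lambda>k. 1)"])
        (use i in \<open>auto simp: weyl_B_def permutes_swap_id act_var_def orth_reflection_def form_inner_indet form_inner_add transpose_def const_poly_simps\<close>)
  qed
  then show "\<exists>s. s \<in> carrier (weyl_B n) \<and> (\<forall>p\<in>linear_forms n. act s p = orth_reflection n \<beta> p)"
    using reflection_reduce by blast
next
  fix s t
  assume s: "s \<in> carrier (weyl_B n) \<and> (\<forall>p\<in>linear_forms n. act s p = orth_reflection n \<beta> p)"
   and t: "t \<in> carrier (weyl_B n) \<and> (\<forall>p\<in>linear_forms n. act t p = orth_reflection n \<beta> p)"
  have lf: "indet k \<in> linear_forms n" if "k \<in> {1..n}" for k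
  proof -
    have "indet k = (\<Sum>j=1..n. const_poly (if j = k then 1 else 0) * indet j)"
      using that by (subst sum.remove[of _ k]) (auto simp: const_poly_simps)
    then show ?thesis unfolding linear_forms_def by fast
  qed
  obtain u e v d where [simp]: "s = (u,e)" "t = (v,d)"
    and h: "u permutes {1..n}" "v permutes {1..n}"
      "\<And>k. k \<in> {1..n} \<Longrightarrow> e k = 1 \<or> e k = -1" "\<And>k. k \<in> {1..n} \<Longrightarrow> d k = 1 \<or> d k = -1"
      "\<And>k. k \<notin> {1..n} \<Longrightarrow> e k = 1" "\<And>k. k \<notin> {1..n} \<Longrightarrow> d k = 1"
    using s t by (cases s; cases t) (auto simp: weyl_B_def)
  have "e k = d k \<and> u k = v k" for k
  proof (cases "k \<in> {1..n}")
    case True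
    have "act_var s k = act_var t k" using s t lf[OF True] by (metis act_indet)
    then show ?thesis using act_var_inj[OF h(3)[OF True] h(4)[OF True]] by (simp add: act_var_def)
  next
    case False
    then show ?thesis using h permutes_not_in by metis
  qed
  then show "s = t" by auto
qed

lemma mem_PIdl: "p \<in> PIdl\<^bsub>poly_ring n\<^esub> a \<longleftrightarrow> (\<exists>q\<in>carrier (poly_ring n). p = q * a)"
  by (auto simp: cgenideal_def poly_ring_def)

lemma mem_H_alpha: "f \<in> carrier (H_alpha n) \<longleftrightarrow>
  f \<in> carrier (weyl_B n) \<rightarrow>\<^sub>E carrier (poly_ring n) \<and>
  (\<forall>w\<in>carrier (weyl_B n). \<forall>\<beta>\<in>pos_roots n. \<exists>q\<in>carrier (poly_ring n).
      f (w \<otimes>\<^bsub>weyl_B n\<^esub> reflection_elt n \<beta>) - f w = q * act w \<beta>)"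
  by (simp add: H_alpha_def mem_PIdl)

lemma reflection_elt:
  assumes "\<beta> \<in> pos_roots n"
  shows "reflection_elt n \<beta> \<in> carrier (weyl_B n)"
    "\<And>p. p \<in> linear_forms n \<Longrightarrow> act (reflection_elt n \<beta>) p = orth_reflection n \<beta> p"
  using theI'[OF reflection_ex1[OF assms]] unfolding reflection_elt_def by auto

lemma algebra_H_alpha: "algebra (poly_ring n) (H_alpha n)"
proof -
  let ?W = "carrier (weyl_B n)" and ?R = "carrier (poly_ring n)"
  have cl: "w \<otimes>\<^bsub>weyl_B n\<^esub> reflection_elt n \<beta> \<in> ?W" if "w \<in> ?W" "\<beta> \<in> pos_roots n" for w \<beta>
    using that group_weyl_B reflection_elt(1) by (meson group.is_monoid monoid.m_closed)
  have val: "f w \<in> ?R" if "f \<in> carrier (H_alpha n)" "w \<in> ?W" for f w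
    using that by (auto simp: mem_H_alpha PiE_def)
  have ext: "restrict f ?W = f" if "f \<in> carrier (H_alpha n)" for f
    using that by (auto simp: mem_H_alpha PiE_def extensional_restrict)
  have cgen: "(\<lambda>w\<in>?W. F w) \<in> carrier (H_alpha n)"
    if "\<And>w. w \<in> ?W \<Longrightarrow> F w \<in> ?R"
      "\<And>w \<beta>. w \<in> ?W \<Longrightarrow> \<beta> \<in> pos_roots n \<Longrightarrow> \<exists>q\<in>?R. F (w \<otimes>\<^bsub>weyl_B n\<^esub> reflection_elt n \<beta>) - F w = q * act w \<beta>" for F
    using that cl by (auto simp: mem_H_alpha)
  have c0: "(\<lambda>w\<in>?W. 0) \<in> carrier (H_alpha n)"
    by (rule cgen) (auto intro!: poly_ring_closed bexI[of _ 0])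
  have c1: "(\<lambda>w\<in>?W. 1) \<in> carrier (H_alpha n)"
    by (rule cgen) (auto intro!: poly_ring_closed bexI[of _ 0])
  have cm: "(\<lambda>w\<in>?W. f w * g w) \<in> carrier (H_alpha n)"
    if f: "f \<in> carrier (H_alpha n)" and g: "g \<in> carrier (H_alpha n)" for f g
  proof (rule cgen)
    fix w \<beta> assume w: "w \<in> ?W" "\<beta> \<in> pos_roots n"
    let ?v = "w \<otimes>\<^bsub>weyl_B n\<^esub> reflection_elt n \<beta>"
    obtain p q where pq: "p \<in> ?R" "q \<in> ?R" "f ?v - f w = p * act w \<beta>" "g ?v - g w = q * act w \<beta>"
      using f g w by (auto simp: mem_H_alpha) blast
    show "\<exists>r\<in>?R. f ?v * g ?v - f w * g w = r * act w \<beta>"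
    proof (intro bexI)
      have "f ?v * g ?v - f w * g w = (f ?v - f w) * g ?v + f w * (g ?v - g w)" by (simp add: algebra_simps)
      then show "f ?v * g ?v - f w * g w = (p * g ?v + f w * q) * act w \<beta>" unfolding pq by (simp add: algebra_simps)
      show "p * g ?v + f w * q \<in> ?R" by (intro poly_ring_closed pq val f g cl w)
    qed
  qed (intro poly_ring_closed val f g)
  have ca: "(\<lambda>w\<in>?W. f w + g w) \<in> carrier (H_alpha n)"
    if f: "f \<in> carrier (H_alpha n)" and g: "g \<in> carrier (H_alpha n)" for f g
  proof (rule cgen)
    fix w \<beta> assume w: "w \<in> ?W" "\<beta> \<in> pos_roots n"
    let ?v = "w \<otimes>\<^bsub>weyl_B n\<^esub> reflection_elt n \<beta>"
    obtain p q where pq: "p \<in> ?R" "q \<in> ?R" "f ?v - f w = p * act w \<beta>" "g ?v - g w = q * act w \<beta>"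
      using f g w by (auto simp: mem_H_alpha) blast
    show "\<exists>r\<in>?R. f ?v + g ?v - (f w + g w) = r * act w \<beta>"
      by (intro bexI[of _ "p + q"] poly_ring_closed pq) (use pq in \<open>simp add: algebra_simps\<close>)
  qed (intro poly_ring_closed val f g)
  have cs: "(\<lambda>w\<in>?W. r * f w) \<in> carrier (H_alpha n)"
    if f: "f \<in> carrier (H_alpha n)" and r: "r \<in> ?R" for f r
  proof (rule cgen)
    fix w \<beta> assume w: "w \<in> ?W" "\<beta> \<in> pos_roots n"
    let ?v = "w \<otimes>\<^bsub>weyl_B n\<^esub> reflection_elt n \<beta>"
    obtain p where p: "p \<in> ?R" "f ?v - f w = p * act w \<beta>"
      using f w by (auto simp: mem_H_alpha) blast
    show "\<exists>q\<in>?R. r * f ?v - r * f w = q * act w \<beta>"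
      by (intro bexI[of _ "r * p"] poly_ring_closed p r) (metis p(2) mult.assoc right_diff_distrib)
  qed (intro poly_ring_closed val f r)
  have mone: "- 1 \<in> ?R" by (intro poly_ring_closed)
  have ops: "add (H_alpha n) = (\<lambda>f g. \<lambda>w\<in>?W. f w + g w)" "mult (H_alpha n) = (\<lambda>f g. \<lambda>w\<in>?W. f w * g w)"
    "zero (H_alpha n) = (\<lambda>w\<in>?W. 0)" "one (H_alpha n) = (\<lambda>w\<in>?W. 1)"
    "smult (H_alpha n) = (\<lambda>r f. \<lambda>w\<in>?W. r * f w)"
    by (simp_all add: H_alpha_def)
  have rops: "add (poly_ring n) = (+)" "mult (poly_ring n) = (*)" "one (poly_ring n) = 1"
    by (simp_all add: poly_ring_def)
  have eqI: "(\<lambda>w\<in>?W. F w) = (\<lambda>w\<in>?W. G w)" if "\<And>w. w \<in> ?W \<Longrightarrow> F w = G w" for F G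
    using that by (auto simp: restrict_def)
  have eqI': "(\<lambda>w\<in>?W. F w) = g" if "g \<in> carrier (H_alpha n)" "\<And>w. w \<in> ?W \<Longrightarrow> F w = g w" for F g
    using eqI[of F g] that ext by simp
  have "cring (H_alpha n)"
  proof (rule cringI)
    show "abelian_group (H_alpha n)"
    proof (rule abelian_groupI)
      fix x assume "x \<in> carrier (H_alpha n)"
      then show "\<exists>y\<in>carrier (H_alpha n). y \<oplus>\<^bsub>H_alpha n\<^esub> x = \<zero>\<^bsub>H_alpha n\<^esub>"
        unfolding ops by (intro bexI[of _ "\<lambda>w\<in>?W. - 1 * x w"] cs mone) (auto intro!: eqI)
    qed (unfold ops, (assumption | (rule ca c0 c1 cm cs; assumption) | (rule c0 c1) | (rule eqI, simp add: algebra_simps) | (rule eqI', assumption, simp))+)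
    show "comm_monoid (H_alpha n)"
      by (rule comm_monoidI) (unfold ops, (assumption | (rule ca c0 c1 cm cs; assumption) | (rule c0 c1) | (rule eqI, simp add: algebra_simps) | (rule eqI', assumption, simp))+)
  qed (unfold ops, (assumption | (rule ca c0 c1 cm cs; assumption) | (rule c0 c1) | (rule eqI, simp add: algebra_simps) | (rule eqI', assumption, simp))+)
  then show ?thesis
    by (intro algebraI cring_poly_ring)
      (unfold ops rops, (assumption | (rule ca c0 c1 cm cs; assumption) | (rule c0 c1) | (rule eqI, simp add: algebra_simps) | (rule eqI', assumption, simp))+)
qed

lemma act_mult_indet:
  "act (w \<otimes>\<^bsub>weyl_B n\<^esub> v) (indet k) = act w (act v (indet k))"
proof (cases w; cases v)
  fix u e t d assume [simp]: "w = (u, e)" "v = (t, d)"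
  have "act w (act v (indet k)) = act w (const_poly (of_int (d k)) * indet (t k))"
    by (simp add: act_indet act_var_def const_poly_simps)
  also have "\<dots> = of_int (d k) * (of_int (e (t k)) * indet (u (t k)))"
    by (simp only: act_const_indet) (simp add: act_var_def const_poly_simps)
  finally show ?thesis by (simp add: act_indet act_var_def weyl_B_def mult.assoc)
qed

end

theory Submission
  imports Defs "HOL-Computational_Algebra.Polynomial"
begin

text \<open>
  Identify \<open>(u, \<epsilon>)\<close> with the list of signed indeterminates \<open>y\<^sub>k = \<epsilon>\<^sub>k x\<^sub>u\<^sub>(\<^sub>k\<^sub>)\<close>, so that \<open>c\<^sub>I\<close> is the monomial
  \<open>y\<^sup>I\<close>. Since \<open>w s\<^sub>\<beta> = s\<^sub>w\<^sub>\<beta> w\<close>, the divisibility conditions say that exchanging two signed indeterminates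
  \<open>x\<close> and \<open>y\<close> (and hence \<open>- x\<close> and \<open>- y\<close>) in the list changes \<open>f\<close> by a multiple of \<open>x - y\<close>.
  The proof is by induction on \<open>n\<close>. Once \<open>y\<^sub>1 = z\<close> is fixed, \<open>f\<close> is a combination of monomials in
  \<open>y\<^sub>2, \<dots>, y\<^sub>n\<close> with coefficients \<open>a\<^sub>J(z)\<close>. These monomials remain independent modulo \<open>z - z'\<close>, so
  \<open>a\<^sub>J(z) - a\<^sub>J(z')\<close> is a multiple of \<open>z - z'\<close>, and Newton interpolation at the \<open>2 n\<close> values of \<open>z\<close>
  writes \<open>a\<^sub>J\<close> as a polynomial in \<open>z\<close> of degree at most \<open>2 n - 1\<close>.
\<close>

section \<open>Interpolation on arrangements of signed elements\<close>

text \<open>Expresses that \<open>a\<close> is a non-zero-divisor in the quotient by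
  \<open>d\<close>. For \<open>d = 0\<close> this is an ordinary non-zero-divisor, so one notion
  serves both for independence and for independence modulo \<open>x - y\<close>.\<close>

definition regular_mod :: "'a::comm_ring_1 \<Rightarrow> 'a \<Rightarrow> bool"
  where "regular_mod d a \<longleftrightarrow> (\<forall>q. d dvd a * q \<longrightarrow> d dvd q)"

lemma regular_modD: "regular_mod d a \<Longrightarrow> d dvd a * q \<Longrightarrow> d dvd q"
  unfolding regular_mod_def by blast

lemma coeff_linear_mult:
  fixes p :: "'a::comm_ring_1 poly"
  shows "coeff ([:- c, 1:] * p) i = (case i of 0 \<Rightarrow> 0 | Suc j \<Rightarrow> coeff p j) - c * coeff p i"
  by (simp add: coeff_pCons split: nat.split)

lemma coeff_const_poly: "coeff [:a:] i = (if i = 0 then a else 0)"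
  by (simp add: coeff_pCons split: nat.split)

text \<open>Newton's scheme: the divided difference \<open>h z\<close> with
  \<open>g z - g c = (z - c) * h z\<close> inherits the pairwise divisibility, because
  \<open>(x - c) * (h x - h y)\<close> is \<open>g x - g y - (x - y) * h y\<close> and
  \<open>x - c\<close> can be cancelled modulo \<open>x - y\<close>. The degree bound is phrased by
  vanishing coefficients so that the empty set of nodes, with the zero polynomial, is
  covered.\<close>

lemma newton_interpolation:
  fixes g :: "'a::comm_ring_1 \<Rightarrow> 'a"
  assumes "finite Z"
    and "\<And>x y z. x \<in> Z \<Longrightarrow> y \<in> Z \<Longrightarrow> z \<in> Z \<Longrightarrow> x \<noteq> y \<Longrightarrow> x \<noteq> z \<Longrightarrow> y \<noteq> z \<Longrightarrow>
      regular_mod (x - y) (x - z)"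
    and "\<And>x y. x \<in> Z \<Longrightarrow> y \<in> Z \<Longrightarrow> x \<noteq> y \<Longrightarrow> x - y dvd g x - g y"
  shows "\<exists>p. (\<forall>i\<ge>card Z. coeff p i = 0) \<and> (\<forall>z\<in>Z. poly p z = g z)"
  using assms
proof (induction Z arbitrary: g rule: finite_induct)
  case empty
  then show ?case by (intro exI[of _ 0]) simp
next
  case (insert c Z)
  have "\<forall>z\<in>Z. \<exists>h. g z - g c = (z - c) * h"
    using insert.prems(2)[of _ c] insert.hyps(2) by (auto simp: dvd_def)
  then obtain h where h: "\<And>z. z \<in> Z \<Longrightarrow> g z - g c = (z - c) * h z"
    by metis
  have "x - y dvd h x - h y" if xy: "x \<in> Z" "y \<in> Z" "x \<noteq> y" for x y
  proof -
    have "(x - c) * (h x - h y) = (x - c) * h x - (y - c) * h y - (x - y) * h y"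
      by (simp add: algebra_simps)
    also have "\<dots> = (g x - g y) - (x - y) * h y"
      by (simp flip: h[OF xy(1)] h[OF xy(2)])
    finally have "(x - c) * (h x - h y) = (g x - g y) - (x - y) * h y" .
    moreover have "x - y dvd g x - g y"
      using insert.prems(2) xy by simp
    ultimately have "x - y dvd (x - c) * (h x - h y)"
      by simp
    moreover have "regular_mod (x - y) (x - c)"
      using insert.prems(1)[of x y c] insert.hyps(2) xy by auto
    ultimately show ?thesis
      by (rule regular_modD[rotated])
  qed
  then have "\<exists>p. (\<forall>i\<ge>card Z. coeff p i = 0) \<and> (\<forall>z\<in>Z. poly p z = h z)"
    by (intro insert.IH insert.prems(1)) simp_all
  then obtain p where p: "\<And>i. i \<ge> card Z \<Longrightarrow> coeff p i = 0" "\<And>z. z \<in> Z \<Longrightarrow> poly p z = h z"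
    by blast
  show ?case
  proof (intro exI conjI allI impI ballI)
    fix i assume "i \<ge> card (insert c Z)"
    then have "i \<ge> Suc (card Z)" using insert.hyps by simp
    then show "coeff ([:- c, 1:] * p + [:g c:]) i = 0"
      unfolding coeff_add coeff_linear_mult coeff_const_poly using p(1) by (auto split: nat.split)
  next
    fix z assume "z \<in> insert c Z"
    then show "poly ([:- c, 1:] * p + [:g c:]) z = g z"
      using h[of z] p(2)[of z] by (auto simp: algebra_simps)
  qed
qed

text \<open>The Vandermonde argument modulo \<open>d\<close>: split off a node \<open>c\<close> by
  synthetic division. The quotient has one coefficient fewer, and its values at the other nodes are
  divisible by \<open>d\<close> since \<open>z - c\<close> can be cancelled modulo
  \<open>d\<close>.\<close>

lemma dvd_coeff_of_dvd_values:
  fixes p :: "'a::comm_ring_1 poly"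
  assumes "finite Z"
    and "\<And>x y. x \<in> Z \<Longrightarrow> y \<in> Z \<Longrightarrow> x \<noteq> y \<Longrightarrow> regular_mod d (x - y)"
    and "\<And>i. i \<ge> card Z \<Longrightarrow> coeff p i = 0"
    and "\<And>z. z \<in> Z \<Longrightarrow> d dvd poly p z"
  shows "d dvd coeff p i"
  using assms
proof (induction Z arbitrary: p i rule: finite_induct)
  case empty
  then show ?case by simp
next
  case (insert c Z)
  define q where "q = synthetic_div p c"
  have p: "p = [:- c, 1:] * q + [:poly p c:]"
    using synthetic_div_correct'[of c p] by (simp add: q_def)
  have "coeff q i = 0" if "i \<ge> card Z" for i
  proof -
    have eq: "coeff p (Suc j) = coeff q j - c * coeff q (Suc j)" for j
      using arg_cong[OF p, of "\<lambda>r. coeff r (Suc j)"]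
      unfolding coeff_add coeff_linear_mult coeff_const_poly by simp
    \<comment> \<open>Downward induction from the degree of \<open>q\<close>: once
      \<open>coeff q (Suc j)\<close> vanishes, \<open>coeff q j\<close> equals
      \<open>coeff p (Suc j)\<close>, which is \<open>0\<close> because \<open>Suc j\<close> is at
      least the number of nodes including \<open>c\<close>.\<close>
    have "coeff q j = 0" if "j \<ge> i" for j
    proof (cases "j > degree q")
      case False
      then have "j \<le> degree q" by simp
      then show ?thesis using that
      proof (induction rule: inc_induct)
        case base
        have "coeff p (Suc (degree q)) = 0"
          using insert.prems(2) insert.hyps \<open>i \<ge> card Z\<close> base by simp
        then show ?case using eq[of "degree q"] by (simp add: coeff_eq_0)
      next
        case (step k)
        have "coeff p (Suc k) = 0"
          using insert.prems(2) insert.hyps \<open>i \<ge> card Z\<close> step by simp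
        then show ?case using eq[of k] step by simp
      qed
    qed (simp add: coeff_eq_0)
    then show ?thesis by simp
  qed
  moreover have "d dvd poly q z" if z: "z \<in> Z" for z
  proof -
    have "poly p z - poly p c = (z - c) * poly q z"
      by (subst p) (simp add: algebra_simps)
    then have "d dvd (z - c) * poly q z"
      using insert.prems(3)[of z] insert.prems(3)[of c] z by (metis dvd_diff insertCI)
    moreover have "regular_mod d (z - c)"
      using insert.prems(1)[of z c] z insert.hyps(2) by auto
    ultimately show ?thesis
      by (rule regular_modD[rotated])
  qed
  ultimately have "d dvd coeff q i" for i
    using insert.IH[of q i] insert.prems(1) by simp
  then have "d dvd coeff ([:- c, 1:] * q + [:poly p c:]) i"
    unfolding coeff_add coeff_linear_mult coeff_const_poly
    using insert.prems(3)[of c] by (auto split: nat.split)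
  then show ?case by (simp only: p[symmetric])
qed

section \<open>Arrangements, signed swaps and the recursion for the exponents\<close>

text \<open>An ordered choice of one element from each pair \<open>{v, - v}\<close> of
  \<open>V\<close>. For the signed indeterminates these lists are the elements of \<open>W\<close>,
  and removing the head leaves an arrangement of a smaller set.\<close>

definition signed_arrangement :: "'a::comm_ring_1 set \<Rightarrow> 'a list \<Rightarrow> bool"
  where "signed_arrangement V ys \<longleftrightarrow>
    V = set ys \<union> uminus ` set ys \<and> sorted_wrt (\<lambda>a b. b \<noteq> a \<and> b \<noteq> - a) ys"

definition list_monom :: "nat list \<Rightarrow> 'a::comm_ring_1 list \<Rightarrow> 'a"
  where "list_monom I ys = (\<Prod>k<length ys. ys ! k ^ (I ! k))"

text \<open>The reflection in \<open>a - b\<close>, seen on signed elements. For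
  \<open>b = - a\<close> it is the sign change of \<open>a\<close>, so that the short roots need no
  separate treatment.\<close>

definition signed_swap :: "'a::comm_ring_1 \<Rightarrow> 'a \<Rightarrow> 'a \<Rightarrow> 'a"
  where "signed_swap a b v =
    (if v = a then b else if v = b then a else if v = - a then - b else if v = - b then - a else v)"

definition sign_symmetric :: "'a::comm_ring_1 set \<Rightarrow> bool"
  where "sign_symmetric V \<longleftrightarrow> finite V \<and> (\<forall>v\<in>V. - v \<in> V \<and> - v \<noteq> v)"

lemma sign_symmetric_remove: "sign_symmetric V \<Longrightarrow> sign_symmetric (V - {z, - z})"
  by (auto simp: sign_symmetric_def)

lemma card_sign_symmetric_remove:
  assumes "sign_symmetric V" "z \<in> V" "card V = 2 * Suc n"
  shows "card (V - {z, - z}) = 2 * n"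
proof -
  have "card {z, - z} = 2" "{z, - z} \<subseteq> V" "finite V"
    using assms by (auto simp: sign_symmetric_def card_insert_if)
  then show ?thesis using assms(3) by (simp add: card_Diff_subset)
qed

lemma signed_arrangement_Cons:
  assumes "sign_symmetric V" "z \<in> V" "signed_arrangement (V - {z, - z}) ys"
  shows "signed_arrangement V (z # ys)"
  using assms by (auto simp: signed_arrangement_def sign_symmetric_def)

lemma signed_arrangement_ConsE:
  assumes "signed_arrangement V (z # ys)"
  shows "z \<in> V" "signed_arrangement (V - {z, - z}) ys"
  using assms by (auto simp: signed_arrangement_def)

lemma list_monom_Cons: "list_monom (i # I) (y # ys) = y ^ i * list_monom I ys"
  by (simp add: list_monom_def prod.lessThan_Suc_shift del: prod.lessThan_Suc)

lemma index_set_0: "index_set 0 = {[]}"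
  by (auto simp: index_set_def)

text \<open>With positions counted from \<open>0\<close>, the strict bound
  \<open>2 * (n - k)\<close> is the number of signed elements still available after \<open>k\<close>
  choices, hence the number of interpolation nodes at that stage.\<close>

lemma index_set_alt: "index_set n = {I. length I = n \<and> (\<forall>k<n. I ! k < 2 * (n - k))}"
proof -
  have "(\<forall>k\<in>{1..n}. I ! (k - 1) \<le> 2 * n - 2 * k + 1) \<longleftrightarrow> (\<forall>k<n. I ! k < 2 * (n - k))" for I :: "nat list"
  proof -
    have "{1..n} = Suc ` {..<n}"
      by (simp add: image_Suc_lessThan)
    then show ?thesis by (force simp: less_Suc_eq_le)
  qed
  then show ?thesis unfolding index_set_def by simp
qed

lemma index_set_Suc: "index_set (Suc n) = (\<lambda>(J, i). i # J) ` (index_set n \<times> {..<2 * Suc n})"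
proof (intro Set.set_eqI iffI)
  fix I assume "I \<in> index_set (Suc n)"
  then obtain i J where I: "I = i # J" and "length J = n" "\<forall>k<Suc n. I ! k < 2 * (Suc n - k)"
    by (auto simp: index_set_alt length_Suc_conv)
  moreover from this(3) have "J ! k < 2 * (n - k)" if "k < n" for k
    using that I by (metis Suc_mono diff_Suc_Suc nth_Cons_Suc)
  moreover have "i < 2 * Suc n"
    using \<open>\<forall>k<Suc n. _\<close>[rule_format, of 0] I by simp
  ultimately have "J \<in> index_set n" "i < 2 * Suc n"
    by (simp_all add: index_set_alt)
  then show "I \<in> (\<lambda>(J, i). i # J) ` (index_set n \<times> {..<2 * Suc n})"
    using I by auto
qed (auto simp: index_set_alt nth_Cons split: nat.split)

lemma finite_index_set: "finite (index_set n)"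
  by (induction n) (auto simp: index_set_0 index_set_Suc)

lemma sum_index_set_Suc:
  "(\<Sum>I\<in>index_set (Suc n). F I) = (\<Sum>J\<in>index_set n. \<Sum>i<2 * Suc n. F (i # J))"
proof -
  have "inj_on (\<lambda>(J, i). i # J) (index_set n \<times> {..<2 * Suc n})"
    by (auto simp: inj_on_def)
  then show ?thesis
    unfolding index_set_Suc sum.cartesian_product by (simp only: sum.reindex o_def case_prod_unfold)
qed

text \<open>For a fixed head \<open>z\<close>, the coefficient of each monomial in the tail is a
  polynomial in \<open>z\<close> with \<open>2 * Suc n\<close> coefficients. Both inductions below
  rest on this regrouping.\<close>

lemma sum_list_monom_Cons:
  fixes z :: "'a::comm_ring_1"
  shows "(\<Sum>I\<in>index_set (Suc n). b I * list_monom I (z # ys)) =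
    (\<Sum>J\<in>index_set n. (\<Sum>i<2 * Suc n. b (i # J) * z ^ i) * list_monom J ys)"
  unfolding sum_index_set_Suc list_monom_Cons sum_distrib_right by (simp only: mult.assoc)

section \<open>Independence of the monomials modulo an element\<close>

text \<open>Induction on the number of pairs: for each head \<open>z\<close> the tail coefficients
  are divisible by \<open>d\<close>. They are polynomials in \<open>z\<close> with as many
  coefficients as \<open>V\<close> has elements, so divisibility of their values passes to their
  coefficients.\<close>

lemma dvd_coefficients_of_dvd_sums:
  fixes d :: "'a::comm_ring_1"
  assumes "sign_symmetric V" "card V = 2 * n"
    and "\<And>x y. x \<in> V \<Longrightarrow> y \<in> V \<Longrightarrow> x \<noteq> y \<Longrightarrow> regular_mod d (x - y)"
    and "\<And>ys. signed_arrangement V ys \<Longrightarrow> d dvd (\<Sum>I\<in>index_set n. b I * list_monom I ys)"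
    and "I \<in> index_set n"
  shows "d dvd b I"
  using assms
proof (induction n arbitrary: V b I)
  case 0
  then have "signed_arrangement V []"
    by (auto simp: signed_arrangement_def sign_symmetric_def)
  from "0.prems"(4)[OF this] "0.prems"(5) show ?case
    by (simp add: index_set_0 list_monom_def)
next
  case (Suc n)
  from Suc.prems(5) obtain i J where I: "I = i # J" "J \<in> index_set n" "i < 2 * Suc n"
    by (auto simp: index_set_Suc)
  \<comment> \<open>Collects the coefficients with tail exponents \<open>J\<close> into a polynomial
    in the head element.\<close>
  define p where "p J = (\<Sum>i<2 * Suc n. monom (b (i # J)) i)" for J
  have coeff_p: "coeff (p J) i = (if i < 2 * Suc n then b (i # J) else 0)" for J i
    by (simp add: p_def coeff_sum coeff_monom del: sum.lessThan_Suc)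
  have poly_p: "poly (p J) z = (\<Sum>i<2 * Suc n. b (i # J) * z ^ i)" for J z
    by (simp add: p_def poly_sum poly_monom del: sum.lessThan_Suc)
  have "d dvd poly (p J) z" if z: "z \<in> V" for z
  proof (rule Suc.IH[of "V - {z, - z}" "\<lambda>J. poly (p J) z"])
    show "sign_symmetric (V - {z, - z})" "card (V - {z, - z}) = 2 * n"
      using Suc.prems(1,2) z by (simp_all only: sign_symmetric_remove card_sign_symmetric_remove)
    show "regular_mod d (x - y)" if "x \<in> V - {z, - z}" "y \<in> V - {z, - z}" "x \<noteq> y" for x y
      using Suc.prems(3) that by blast
    show "d dvd (\<Sum>J\<in>index_set n. poly (p J) z * list_monom J ys)"
      if "signed_arrangement (V - {z, - z}) ys" for ys
      using Suc.prems(4)[OF signed_arrangement_Cons[OF Suc.prems(1) z that]]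
      unfolding sum_list_monom_Cons poly_p .
  qed (rule I(2))
  then have "d dvd coeff (p J) i"
    using Suc.prems(1-3) by (intro dvd_coeff_of_dvd_values[of V]) (auto simp: sign_symmetric_def coeff_p)
  then show ?case using I by (simp add: coeff_p)
qed

section \<open>Congruences of monomials and the effect of swaps on arrangements\<close>

lemma dvd_power_diff:
  fixes d :: "'a::comm_ring_1"
  shows "d dvd a - b \<Longrightarrow> d dvd a ^ m - b ^ m"
  by (metis dvd_mult2 power_diff_sumr2)

lemma dvd_prod_diff:
  fixes d :: "'a::comm_ring_1"
  assumes "\<And>k. k \<in> A \<Longrightarrow> d dvd f k - g k"
  shows "d dvd prod f A - prod g A"
  using assms
proof (induction A rule: infinite_finite_induct)
  case (insert x A)
  have "f x * prod f A - g x * prod g A = (f x - g x) * prod f A + g x * (prod f A - prod g A)"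
    by (simp add: algebra_simps)
  then show ?case using insert by simp
qed simp_all

lemma dvd_list_monom_diff:
  fixes d :: "'a::comm_ring_1"
  assumes "length ys = length zs" "\<And>k. k < length ys \<Longrightarrow> d dvd ys ! k - zs ! k"
  shows "d dvd list_monom I ys - list_monom I zs"
  unfolding list_monom_def assms(1)[symmetric]
  using assms(2) by (intro dvd_prod_diff dvd_power_diff) simp

lemma signed_swap_same: "signed_swap a b a = b"
  by (simp add: signed_swap_def)

lemma dvd_signed_swap_diff: "a - b dvd signed_swap a b v - v"
proof -
  have "a - b dvd b - a" by (metis dvd_refl dvd_minus_iff minus_diff_eq)
  then show ?thesis by (auto simp: signed_swap_def algebra_simps)
qed

lemma signed_swap_uminus:
  "- a \<noteq> a \<Longrightarrow> - b \<noteq> b \<Longrightarrow> signed_swap a b (- v) = - signed_swap a b v"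
  by (auto simp: signed_swap_def minus_equation_iff)

lemma signed_swap_involution:
  "- a \<noteq> a \<Longrightarrow> - b \<noteq> b \<Longrightarrow> signed_swap a b (signed_swap a b v) = v"
  by (auto simp: signed_swap_def minus_equation_iff)

lemma signed_swap_mem:
  "sign_symmetric V \<Longrightarrow> a \<in> V \<Longrightarrow> b \<in> V \<Longrightarrow> v \<in> V \<Longrightarrow> signed_swap a b v \<in> V"
  by (auto simp: signed_swap_def sign_symmetric_def)

text \<open>The swap is an involution of \<open>V\<close> that commutes with negation, so it
  permutes the pairs \<open>{v, - v}\<close>.\<close>

lemma signed_arrangement_map_swap:
  assumes "sign_symmetric V" "a \<in> V" "b \<in> V" "signed_arrangement V ys"
  shows "signed_arrangement V (map (signed_swap a b) ys)"
proof -
  let ?s = "signed_swap a b"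
  have ab: "- a \<noteq> a" "- b \<noteq> b" using assms(1-3) by (auto simp: sign_symmetric_def)
  note u = signed_swap_uminus[OF ab] and i = signed_swap_involution[OF ab]
  have V: "V = set ys \<union> uminus ` set ys" and s: "sorted_wrt (\<lambda>a b. b \<noteq> a \<and> b \<noteq> - a) ys"
    using assms(4) by (auto simp: signed_arrangement_def)
  have "?s ` V = V"
  proof
    show "?s ` V \<subseteq> V" using signed_swap_mem[OF assms(1-3)] by auto
    show "V \<subseteq> ?s ` V"
    proof
      fix v assume "v \<in> V"
      then show "v \<in> ?s ` V"
        using signed_swap_mem[OF assms(1-3)] i[of v] by (intro image_eqI[of _ _ "?s v"]) auto
    qed
  qed
  then have "V = set (map ?s ys) \<union> uminus ` set (map ?s ys)"
    by (subst (asm) (1) V) (simp add: image_Un image_image u)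
  moreover have "sorted_wrt (\<lambda>a b. b \<noteq> a \<and> b \<noteq> - a) (map ?s ys)"
    unfolding sorted_wrt_map
    by (rule sorted_wrt_mono_rel[OF _ s]) (metis i u)
  ultimately show ?thesis by (simp add: signed_arrangement_def)
qed

text \<open>Prepend \<open>z\<close>, apply the swap, which turns the head into \<open>z'\<close>,
  and drop the head again. This matches the tails that occur for two different heads.\<close>

lemma signed_arrangement_map_swap_remove:
  assumes "sign_symmetric V" "z \<in> V" "z' \<in> V" "signed_arrangement (V - {z, - z}) ys"
  shows "signed_arrangement (V - {z', - z'}) (map (signed_swap z z') ys)"
  using signed_arrangement_ConsE(2)[of V z' "map (signed_swap z z') ys"]
    signed_arrangement_map_swap[OF assms(1-3) signed_arrangement_Cons[OF assms(1,2,4)]]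
  by (simp add: signed_swap_same)

section \<open>Expansion of functions satisfying the divisibility conditions\<close>

text \<open>The spanning statement over an arbitrary commutative ring. The first regularity
  hypothesis feeds Newton interpolation in the head; the second makes the tail monomials independent
  modulo \<open>x - y\<close> once \<open>x\<close> is chosen as head. All hypotheses pass to
  \<open>V - {z, - z}\<close>.\<close>

lemma gkm_function_eq_sum:
  fixes F :: "'a::comm_ring_1 list \<Rightarrow> 'a"
  assumes "sign_symmetric V" "card V = 2 * n"
    and "\<And>x y z. x \<in> V \<Longrightarrow> y \<in> V \<Longrightarrow> z \<in> V \<Longrightarrow> x \<noteq> y \<Longrightarrow> x \<noteq> z \<Longrightarrow> y \<noteq> z \<Longrightarrow>
      regular_mod (x - y) (x - z)"
    and "\<And>x y v w. x \<in> V \<Longrightarrow> y \<in> V \<Longrightarrow> x \<noteq> y \<Longrightarrow> v \<in> V - {x, - x} \<Longrightarrow> w \<in> V - {x, - x} \<Longrightarrow> v \<noteq> w \<Longrightarrow>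
      regular_mod (x - y) (v - w)"
    and "\<And>ys x y. signed_arrangement V ys \<Longrightarrow> x \<in> V \<Longrightarrow> y \<in> V \<Longrightarrow> x \<noteq> y \<Longrightarrow>
      x - y dvd F (map (signed_swap x y) ys) - F ys"
  shows "\<exists>b. \<forall>ys. signed_arrangement V ys \<longrightarrow> F ys = (\<Sum>I\<in>index_set n. b I * list_monom I ys)"
  using assms
proof (induction n arbitrary: V F)
  case 0
  then have Nil: "ys = []" if "signed_arrangement V ys" for ys
    using that by (auto simp: signed_arrangement_def sign_symmetric_def)
  have "F ys = (\<Sum>I\<in>index_set 0. F [] * list_monom I ys)" if "signed_arrangement V ys" for ys
    unfolding Nil[OF that] by (simp add: index_set_0 list_monom_def)
  then show ?case by (intro exI[of _ "\<lambda>_. F []"] allI impI)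
next
  case (Suc n)
  note sym = Suc.prems(1)
  have "\<forall>z\<in>V. \<exists>b. \<forall>ys. signed_arrangement (V - {z, - z}) ys \<longrightarrow>
    F (z # ys) = (\<Sum>J\<in>index_set n. b J * list_monom J ys)"
  proof
    fix z assume z: "z \<in> V"
    let ?V = "V - {z, - z}"
    show "\<exists>b. \<forall>ys. signed_arrangement ?V ys \<longrightarrow> F (z # ys) = (\<Sum>J\<in>index_set n. b J * list_monom J ys)"
    proof (rule Suc.IH)
      show "sign_symmetric ?V" "card ?V = 2 * n"
        using sym Suc.prems(2) z by (simp_all only: sign_symmetric_remove card_sign_symmetric_remove)
      show "regular_mod (x - y) (x - v)"
        if "x \<in> ?V" "y \<in> ?V" "v \<in> ?V" "x \<noteq> y" "x \<noteq> v" "y \<noteq> v" for x y v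
        using Suc.prems(3) that by blast
      show "regular_mod (x - y) (v - w)"
        if "x \<in> ?V" "y \<in> ?V" "x \<noteq> y" "v \<in> ?V - {x, - x}" "w \<in> ?V - {x, - x}" "v \<noteq> w" for x y v w
        using Suc.prems(4) that by blast
      show "x - y dvd F (z # map (signed_swap x y) ys) - F (z # ys)"
        if "signed_arrangement ?V ys" "x \<in> ?V" "y \<in> ?V" "x \<noteq> y" for ys x y
      proof -
        have "signed_swap x y z = z" using that(2,3) by (auto simp: signed_swap_def)
        then show ?thesis
          using Suc.prems(5)[OF signed_arrangement_Cons[OF sym z that(1)], of x y] that by simp
      qed
    qed
  qed
  from bchoice[OF this] obtain a where a: "\<And>z ys. z \<in> V \<Longrightarrow> signed_arrangement (V - {z, - z}) ys \<Longrightarrow>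
    F (z # ys) = (\<Sum>J\<in>index_set n. a z J * list_monom J ys)"
    by blast
  have "x - y dvd a x J - a y J" if x: "x \<in> V" and y: "y \<in> V" "x \<noteq> y" and J: "J \<in> index_set n" for x y J
  proof (rule dvd_coefficients_of_dvd_sums[of "V - {x, - x}" n _ "\<lambda>J. a x J - a y J"])
    show "sign_symmetric (V - {x, - x})" "card (V - {x, - x}) = 2 * n"
      using sym Suc.prems(2) x by (simp_all only: sign_symmetric_remove card_sign_symmetric_remove)
    show "regular_mod (x - y) (v - w)" if "v \<in> V - {x, - x}" "w \<in> V - {x, - x}" "v \<noteq> w" for v w
      using Suc.prems(4) x y that by blast
    fix ys assume ys: "signed_arrangement (V - {x, - x}) ys"
    \<comment> \<open>The swap sends \<open>x # ys\<close> to \<open>y # ?zs\<close>, so the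
      divisibility condition compares the expansions for the heads \<open>x\<close> and
      \<open>y\<close>, though at different tails.\<close>
    let ?zs = "map (signed_swap x y) ys"
    have "x - y dvd F (y # ?zs) - F (x # ys)"
      using Suc.prems(5)[OF signed_arrangement_Cons[OF sym x ys] x y] by (simp add: signed_swap_same)
    moreover have "F (y # ?zs) = (\<Sum>J\<in>index_set n. a y J * list_monom J ?zs)"
      using a[OF y(1)] signed_arrangement_map_swap_remove[OF sym x y(1) ys] by blast
    moreover have "F (x # ys) = (\<Sum>J\<in>index_set n. a x J * list_monom J ys)"
      using a[OF x ys] .
    ultimately have 1: "x - y dvd (\<Sum>J\<in>index_set n. a y J * list_monom J ?zs) -
        (\<Sum>J\<in>index_set n. a x J * list_monom J ys)"
      by simp
    \<comment> \<open>The two tails agree entrywise modulo \<open>x - y\<close>, so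
      \<open>?zs\<close> may be replaced by \<open>ys\<close> at the cost of a multiple of
      \<open>x - y\<close>.\<close>
    have "x - y dvd list_monom J ?zs - list_monom J ys" for J
      by (rule dvd_list_monom_diff) (simp_all add: dvd_signed_swap_diff)
    then have 2: "x - y dvd (\<Sum>J\<in>index_set n. a y J * (list_monom J ?zs - list_monom J ys))"
      by (intro dvd_sum) simp
    have "(\<Sum>J\<in>index_set n. (a x J - a y J) * list_monom J ys) =
      (\<Sum>J\<in>index_set n. a y J * (list_monom J ?zs - list_monom J ys)) -
      ((\<Sum>J\<in>index_set n. a y J * list_monom J ?zs) - (\<Sum>J\<in>index_set n. a x J * list_monom J ys))"
      by (simp add: algebra_simps sum_subtractf sum.distrib)
    then show "x - y dvd (\<Sum>J\<in>index_set n. (a x J - a y J) * list_monom J ys)"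
      using dvd_diff[OF 2 1] by simp
  qed (rule J)
  then have "\<forall>J\<in>index_set n. \<exists>p. (\<forall>i\<ge>card V. coeff p i = 0) \<and> (\<forall>z\<in>V. poly p z = a z J)"
    using sym by (intro ballI newton_interpolation Suc.prems(3)) (auto simp: sign_symmetric_def)
  from bchoice[OF this] obtain p where
    p: "\<And>J i. J \<in> index_set n \<Longrightarrow> i \<ge> 2 * Suc n \<Longrightarrow> coeff (p J) i = 0"
      "\<And>J z. J \<in> index_set n \<Longrightarrow> z \<in> V \<Longrightarrow> poly (p J) z = a z J"
    unfolding Suc.prems(2) by blast
  have poly_p: "poly (p J) z = (\<Sum>i<2 * Suc n. coeff (p J) i * z ^ i)" if "J \<in> index_set n" for J z
    unfolding poly_altdef
  proof (rule sum.mono_neutral_cong)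
    show "coeff (p J) i * z ^ i = 0" if "i \<in> {..degree (p J)} - {..<2 * Suc n}" for i
      using p(1)[OF \<open>J \<in> _\<close>, of i] that by auto
  qed (auto simp: coeff_eq_0)
  show ?case
  proof (intro exI allI impI)
    fix ys assume ys: "signed_arrangement V ys"
    have "V \<noteq> {}" using Suc.prems(2) by auto
    then obtain z zs where ys_eq: "ys = z # zs"
      using ys by (cases ys) (auto simp: signed_arrangement_def)
    note z = signed_arrangement_ConsE[OF ys[unfolded ys_eq]]
    have "F ys = (\<Sum>J\<in>index_set n. poly (p J) z * list_monom J zs)"
      using a[OF z] p(2) z(1) by (simp add: ys_eq)
    \<comment> \<open>The coefficient belonging to \<open>i # J\<close> is the \<open>i\<close>-th
      coefficient of the interpolant \<open>p J\<close>.\<close>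
    also have "\<dots> = (\<Sum>I\<in>index_set (Suc n). coeff (p (tl I)) (hd I) * list_monom I ys)"
      unfolding ys_eq sum_list_monom_Cons by (simp add: poly_p del: sum.lessThan_Suc)
    finally show "F ys = (\<Sum>I\<in>index_set (Suc n). coeff (p (tl I)) (hd I) * list_monom I ys)" .
  qed
qed

section \<open>Substitution homomorphisms and signed indeterminates\<close>

text \<open>A common form for three substitutions: the action of \<open>W\<close>, the elimination
  of an indeterminate modulo \<open>x - y\<close>, and the truncation to the first \<open>n\<close>
  indeterminates.\<close>

definition poly_subst :: "(nat \<Rightarrow> rpoly) \<Rightarrow> rpoly \<Rightarrow> rpoly"
  where "poly_subst \<phi> p = (\<Sum>m\<in>Poly_Mapping.keys p. const_poly (Poly_Mapping.lookup p m) *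
    (\<Prod>k\<in>Poly_Mapping.keys m. \<phi> k ^ Poly_Mapping.lookup m k))"

lemma act_eq_poly_subst: "act w = poly_subst (act_var w)"
  by (simp add: fun_eq_iff act_def poly_subst_def)

lemma poly_subst_add: "poly_subst \<phi> (p + q) = poly_subst \<phi> p + poly_subst \<phi> q"
  unfolding poly_subst_def
  by (rule setsum_keys_plus_distrib) (simp_all add: const_poly_def single_add algebra_simps)

lemma poly_subst_0: "poly_subst \<phi> 0 = 0"
  by (simp add: poly_subst_def)

lemma poly_subst_sum: "poly_subst \<phi> (sum f A) = (\<Sum>a\<in>A. poly_subst \<phi> (f a))"
  by (induction A rule: infinite_finite_induct) (simp_all add: poly_subst_add poly_subst_0)

lemma poly_subst_single: "poly_subst \<phi> (Poly_Mapping.single m a) =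
  const_poly a * (\<Prod>k\<in>Poly_Mapping.keys m. \<phi> k ^ Poly_Mapping.lookup m k)"
  by (auto simp: poly_subst_def const_poly_def)

lemma poly_subst_const: "poly_subst \<phi> (const_poly a) = const_poly a"
  using poly_subst_single[of \<phi> 0 a] by (simp add: const_poly_def)

lemma poly_subst_1: "poly_subst \<phi> 1 = 1"
  using poly_subst_const[of \<phi> 1] by (simp add: const_poly_simps)

lemma poly_subst_indet: "poly_subst \<phi> (indet k) = \<phi> k"
  unfolding indet_def poly_subst_single by (simp add: const_poly_simps)

lemma sum_singles_eq:
  fixes p :: "'a \<Rightarrow>\<^sub>0 'b::comm_monoid_add"
  shows "(\<Sum>m\<in>Poly_Mapping.keys p. Poly_Mapping.single m (Poly_Mapping.lookup p m)) = p"
proof (rule poly_mapping_eqI)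
  fix k
  have "Poly_Mapping.lookup (\<Sum>m\<in>Poly_Mapping.keys p. Poly_Mapping.single m (Poly_Mapping.lookup p m)) k =
      (\<Sum>m\<in>Poly_Mapping.keys p. if m = k then Poly_Mapping.lookup p m else 0)"
    by (simp add: lookup_sum lookup_single when_def)
  also have "\<dots> = Poly_Mapping.lookup p k"
    by (simp add: in_keys_iff)
  finally show "Poly_Mapping.lookup (\<Sum>m\<in>Poly_Mapping.keys p. Poly_Mapping.single m (Poly_Mapping.lookup p m)) k =
    Poly_Mapping.lookup p k" .
qed

lemma poly_subst_mult: "poly_subst \<phi> (p * q) = poly_subst \<phi> p * poly_subst \<phi> q"
proof -
  let ?M = "\<lambda>m. \<Prod>k\<in>Poly_Mapping.keys m. \<phi> k ^ Poly_Mapping.lookup m k"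
  \<comment> \<open>Exponent \<open>0\<close> contributes a factor \<open>1\<close>, so the product
    may run over any finite superset of the support; two monomials can then share one index
    set.\<close>
  have ext: "?M m = (\<Prod>k\<in>A. \<phi> k ^ Poly_Mapping.lookup m k)"
    if "finite A" "Poly_Mapping.keys m \<subseteq> A" for m A
    using that by (intro prod.mono_neutral_left) (auto simp: in_keys_iff)
  have M_add: "?M (m + m') = ?M m * ?M m'" for m m'
  proof -
    let ?A = "Poly_Mapping.keys m \<union> Poly_Mapping.keys m'"
    have "?M (m + m') = (\<Prod>k\<in>?A. \<phi> k ^ Poly_Mapping.lookup (m + m') k)"
      by (rule ext) (use Poly_Mapping.keys_add[of m m'] in auto)
    also have "\<dots> = (\<Prod>k\<in>?A. \<phi> k ^ Poly_Mapping.lookup m k) * (\<Prod>k\<in>?A. \<phi> k ^ Poly_Mapping.lookup m' k)"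
      by (simp add: lookup_add power_add prod.distrib)
    also have "\<dots> = ?M m * ?M m'"
      using ext[of ?A m] ext[of ?A m'] by simp
    finally show ?thesis .
  qed
  have single: "poly_subst \<phi> (Poly_Mapping.single m a * Poly_Mapping.single m' b) =
    poly_subst \<phi> (Poly_Mapping.single m a) * poly_subst \<phi> (Poly_Mapping.single m' b)" for m a m' b
    unfolding mult_single poly_subst_single M_add by (simp add: const_poly_simps algebra_simps)
  have "p * q = (\<Sum>m\<in>Poly_Mapping.keys p. \<Sum>m'\<in>Poly_Mapping.keys q.
    Poly_Mapping.single m (Poly_Mapping.lookup p m) * Poly_Mapping.single m' (Poly_Mapping.lookup q m'))"
    unfolding sum_product[symmetric] sum_singles_eq ..
  then have "poly_subst \<phi> (p * q) =
    poly_subst \<phi> (\<Sum>m\<in>Poly_Mapping.keys p. Poly_Mapping.single m (Poly_Mapping.lookup p m)) *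
    poly_subst \<phi> (\<Sum>m\<in>Poly_Mapping.keys q. Poly_Mapping.single m (Poly_Mapping.lookup q m))"
    by (simp only: poly_subst_sum single sum_product)
  then show ?thesis by (simp only: sum_singles_eq)
qed

lemma poly_subst_uminus: "poly_subst \<phi> (- p) = - poly_subst \<phi> p"
  using poly_subst_add[of \<phi> "- p" p] by (simp add: poly_subst_0 eq_neg_iff_add_eq_0)

lemma poly_subst_diff: "poly_subst \<phi> (p - q) = poly_subst \<phi> p - poly_subst \<phi> q"
  using poly_subst_add[of \<phi> p "- q"] by (simp add: poly_subst_uminus)

lemma poly_subst_power: "poly_subst \<phi> (p ^ m) = poly_subst \<phi> p ^ m"
  by (induction m) (simp_all add: poly_subst_1 poly_subst_mult)

lemma poly_subst_prod: "poly_subst \<phi> (prod f A) = (\<Prod>a\<in>A. poly_subst \<phi> (f a))"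
  by (induction A rule: infinite_finite_induct) (simp_all add: poly_subst_1 poly_subst_mult)

lemma poly_subst_id: "poly_subst indet p = p"
proof -
  have pow: "indet k ^ e = Poly_Mapping.single (Poly_Mapping.single k e) 1" for k e
    by (induction e) (simp_all add: indet_def mult_single flip: single_add single_one)
  have prod: "(\<Prod>k\<in>A. Poly_Mapping.single (g k) 1 :: rpoly) = Poly_Mapping.single (\<Sum>k\<in>A. g k) 1" for g and A :: "nat set"
    by (induction A rule: infinite_finite_induct) (simp_all add: mult_single)
  show ?thesis
    unfolding poly_subst_def pow prod sum_singles_eq
    by (simp add: const_poly_def mult_single sum_singles_eq)
qed

lemma dvd_poly_subst_diff:
  assumes "\<And>k. d dvd \<phi> k - \<psi> k"
  shows "d dvd poly_subst \<phi> p - poly_subst \<psi> p"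
  unfolding poly_subst_def sum_subtractf[symmetric] right_diff_distrib[symmetric]
  by (intro dvd_sum dvd_mult dvd_prod_diff dvd_power_diff assms)

section \<open>Signed indeterminates and regularity of their differences\<close>

lemma indet_eq_iff: "indet i = indet j \<longleftrightarrow> i = j"
  using act_var_inj[of 1 1 i j] by auto

lemma indet_neq_uminus: "indet i \<noteq> - indet j"
  using act_var_inj[of 1 "-1" i j] by auto

lemma indet_neq_0: "indet i \<noteq> 0"
  using indet_neq_uminus[of i i] by auto

text \<open>The left-hand side is \<open>2 * x\<close>, and 2 is invertible in the real
  coefficients. Hence divisibility by \<open>x\<close> and by \<open>x - - x\<close> amount to the
  same.\<close>

lemma diff_uminus_dvd: "x - - x dvd (x :: rpoly)"
proof -
  have "const_poly (1/2) * (x - - x) = (const_poly (1/2) + const_poly (1/2)) * x"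
    by (simp add: algebra_simps)
  also have "\<dots> = x"
    by (simp add: const_poly_simps(4) flip: const_poly_simps(1))
  finally show ?thesis by (metis dvd_triv_right)
qed

definition signed_indets :: "nat \<Rightarrow> rpoly set"
  where "signed_indets n = indet ` {1..n} \<union> (\<lambda>k. - indet k) ` {1..n}"

lemma signed_indets_cases:
  assumes "x \<in> signed_indets n"
  obtains i where "i \<in> {1..n}" "x = indet i \<or> x = - indet i"
  using assms by (auto simp: signed_indets_def)

lemma signed_indets_uminus: "x \<in> signed_indets n \<Longrightarrow> - x \<in> signed_indets n"
  by (auto simp: signed_indets_def)

lemma signed_indets_neq_0: "x \<in> signed_indets n \<Longrightarrow> x \<noteq> 0"
  by (auto simp: signed_indets_def indet_neq_0)

lemma signed_indets_neq_uminus: "x \<in> signed_indets n \<Longrightarrow> - x \<noteq> x"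
  using indet_neq_uminus by (metis signed_indets_cases minus_minus)

lemma sign_symmetric_signed_indets: "sign_symmetric (signed_indets n)"
proof -
  have "finite (signed_indets n)" by (simp add: signed_indets_def)
  then show ?thesis
    unfolding sign_symmetric_def using signed_indets_uminus signed_indets_neq_uminus by blast
qed

lemma card_signed_indets: "card (signed_indets n) = 2 * n"
proof -
  have "card (signed_indets n) = card (indet ` {1..n}) + card ((\<lambda>k. - indet k) ` {1..n})"
    unfolding signed_indets_def by (rule card_Un_disjoint) (auto simp: indet_neq_uminus)
  also have "\<dots> = n + n"
    by (simp add: card_image inj_on_def indet_eq_iff)
  finally show ?thesis by simp
qed

text \<open>
  Modulo \<open>x - y\<close> the indeterminate underlying \<open>x\<close> can be eliminated, by \<open>y\<close> or, if \<open>y = - x\<close>,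
  by \<open>0\<close>; the substitution is injective on the remaining signed indeterminates.
\<close>

lemma regular_mod_signed_indets:
  assumes V: "x \<in> signed_indets n" "y \<in> signed_indets n" "v \<in> signed_indets n" "w \<in> signed_indets n"
    and neq: "x \<noteq> y" "v \<noteq> w" "{v, w} \<noteq> {x, y}" "{v, w} \<noteq> {- x, - y}"
  shows "regular_mod (x - y) (v - w)"
proof -
  obtain i where i: "x = indet i \<or> x = - indet i"
    using V(1) by (rule signed_indets_cases)
  define y' where "y' = (if y = - x then 0 else y)"
  define \<phi> where "\<phi> = indet(i := if x = indet i then y' else - y')"
  let ?\<sigma> = "poly_subst \<phi>"
  have \<sigma>_x: "?\<sigma> x = y'"
    using i by (auto simp: \<phi>_def poly_subst_indet poly_subst_uminus indet_neq_uminus indet_neq_uminus[symmetric])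
  then have \<sigma>_mx: "?\<sigma> (- x) = - y'"
    by (simp add: poly_subst_uminus)
  have \<sigma>_fix: "?\<sigma> z = z" if z: "z \<in> signed_indets n" "z \<noteq> x" "z \<noteq> - x" for z
  proof -
    obtain j where j: "z = indet j \<or> z = - indet j"
      using z(1) by (rule signed_indets_cases)
    then have "j \<noteq> i" using i z(2,3) by auto
    then show ?thesis
      using j by (auto simp: \<phi>_def poly_subst_indet poly_subst_uminus)
  qed
  \<comment> \<open>If \<open>y = - x\<close>, then \<open>x\<close> itself is a multiple of
    \<open>x - y\<close>, which is why \<open>y'\<close> is \<open>0\<close> in that case.\<close>
  have "x - y dvd x - y'"
  proof (cases "y = - x")
    case True
    then show ?thesis
      using diff_uminus_dvd[of x] by (simp add: y'_def)
  qed (simp add: y'_def)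
  then have "x - y dvd indet k - \<phi> k" for k
    using i dvd_minus_iff[of "x - y" "x - y'"] by (auto simp: \<phi>_def indet_neq_uminus[symmetric] add.commute)
  then have cong: "x - y dvd q - ?\<sigma> q" for q
    using dvd_poly_subst_diff[of "x - y" indet \<phi> q] by (simp add: poly_subst_id)
  have \<sigma>_0: "?\<sigma> (x - y) = 0"
    using \<sigma>_x \<sigma>_mx \<sigma>_fix[OF V(2)] neq(1) by (auto simp: poly_subst_diff y'_def)
  have val: "?\<sigma> z = (if z = x then y' else if z = - x then - y' else z)" if "z \<in> signed_indets n" for z
    using \<sigma>_x \<sigma>_mx \<sigma>_fix[OF that] by auto
  \<comment> \<open>A collision of images would force \<open>{v, w}\<close> to be
    \<open>{x, y}\<close> or \<open>{- x, - y}\<close>, or a signed indeterminate to be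
    \<open>0\<close> or its own negative.\<close>
  have "?\<sigma> v \<noteq> ?\<sigma> w"
    unfolding val[OF V(3)] val[OF V(4)] y'_def
    using neq signed_indets_neq_0[OF V(3)] signed_indets_neq_0[OF V(4)] signed_indets_neq_uminus[OF V(2)]
    by (auto simp: insert_commute)
  then have nz: "?\<sigma> (v - w) \<noteq> 0"
    by (simp add: poly_subst_diff)
  show ?thesis
    unfolding regular_mod_def
  proof (intro allI impI)
    fix q assume "x - y dvd (v - w) * q"
    then obtain r where "(v - w) * q = (x - y) * r" by (auto simp: dvd_def)
    \<comment> \<open>The substitution kills \<open>x - y\<close> but not \<open>v - w\<close>. As
      there are no zero divisors, it kills \<open>q\<close>, which is congruent to its image modulo
      \<open>x - y\<close>.\<close>
    then have "?\<sigma> (v - w) * ?\<sigma> q = 0"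
      by (metis poly_subst_mult \<sigma>_0 mult_zero_left)
    then have "?\<sigma> q = 0" using nz by simp
    then show "x - y dvd q" using cong[of q] by simp
  qed
qed

section \<open>Descent to the ring in \<open>n\<close> indeterminates\<close>

lemma poly_ring_closed_more:
  "const_poly a \<in> carrier (poly_ring n)"
  "k \<in> {1..n} \<Longrightarrow> indet k \<in> carrier (poly_ring n)"
  "p \<in> carrier (poly_ring n) \<Longrightarrow> p ^ m \<in> carrier (poly_ring n)"
  "(\<And>a. a \<in> A \<Longrightarrow> f a \<in> carrier (poly_ring n)) \<Longrightarrow> sum f A \<in> carrier (poly_ring n)"
  "(\<And>a. a \<in> A \<Longrightarrow> f a \<in> carrier (poly_ring n)) \<Longrightarrow> prod f A \<in> carrier (poly_ring n)"
proof -
  show "const_poly a \<in> carrier (poly_ring n)" "k \<in> {1..n} \<Longrightarrow> indet k \<in> carrier (poly_ring n)"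
    by (auto simp: poly_ring_carrier_alt const_poly_def indet_def)
  show "p \<in> carrier (poly_ring n) \<Longrightarrow> p ^ m \<in> carrier (poly_ring n)"
    by (induction m) (simp_all add: poly_ring_closed)
  show "sum f A \<in> carrier (poly_ring n)" if "\<And>a. a \<in> A \<Longrightarrow> f a \<in> carrier (poly_ring n)"
    using that by (induction A rule: infinite_finite_induct) (simp_all add: poly_ring_closed)
  show "prod f A \<in> carrier (poly_ring n)" if "\<And>a. a \<in> A \<Longrightarrow> f a \<in> carrier (poly_ring n)"
    using that by (induction A rule: infinite_finite_induct) (simp_all add: poly_ring_closed)
qed

lemma poly_subst_closed:
  assumes "\<And>k. \<phi> k \<in> carrier (poly_ring n)"
  shows "poly_subst \<phi> p \<in> carrier (poly_ring n)"
  unfolding poly_subst_def by (intro poly_ring_closed poly_ring_closed_more assms)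

text \<open>A retraction of the ambient polynomial ring onto \<open>poly_ring n\<close>. Quotients
  and coefficients are first found in the ambient ring and then brought back by it.\<close>

definition truncate_indets :: "nat \<Rightarrow> rpoly \<Rightarrow> rpoly"
  where "truncate_indets n = poly_subst (\<lambda>k. if k \<in> {1..n} then indet k else 0)"

lemma truncate_indets_closed: "truncate_indets n p \<in> carrier (poly_ring n)"
  unfolding truncate_indets_def by (rule poly_subst_closed) (simp add: poly_ring_closed poly_ring_closed_more)

lemma truncate_indets_id:
  assumes "p \<in> carrier (poly_ring n)"
  shows "truncate_indets n p = p"
proof -
  have "truncate_indets n p = poly_subst indet p"
    unfolding truncate_indets_def poly_subst_def
    using assms by (intro sum.cong prod.cong arg_cong2[where f = "(*)"] refl) (force simp: poly_ring_carrier_alt)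
  then show ?thesis by (simp add: poly_subst_id)
qed

text \<open>Truncating an equation \<open>p = a * q\<close> fixes \<open>p\<close> and
  \<open>a\<close> and moves \<open>q\<close> into the subring.\<close>

lemma dvd_in_poly_ring:
  assumes "p \<in> carrier (poly_ring n)" "a \<in> carrier (poly_ring n)" "a dvd p"
  shows "\<exists>q\<in>carrier (poly_ring n). p = q * a"
proof -
  obtain q where "p = a * q" using assms(3) by (auto simp: dvd_def)
  then have "truncate_indets n p = truncate_indets n a * truncate_indets n q"
    by (simp add: truncate_indets_def poly_subst_mult)
  then show ?thesis
    using assms truncate_indets_closed by (metis truncate_indets_id mult.commute)
qed

section \<open>Signed permutations as arrangements\<close>

definition point :: "nat \<Rightarrow> signed_perm \<Rightarrow> rpoly list"
  where "point n w = map (act_var w) [1..<Suc n]"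

lemma length_point: "length (point n w) = n"
  by (simp add: point_def)

lemma nth_point: "k < n \<Longrightarrow> point n w ! k = act_var w (Suc k)"
  by (simp add: point_def del: upt_Suc)

lemma point_eq_iff: "point n w = point n w' \<longleftrightarrow> (\<forall>k\<in>{1..n}. act_var w k = act_var w' k)"
  by (auto simp: point_def simp del: upt_Suc)

lemma c_class_eq_list_monom:
  assumes "w \<in> carrier (weyl_B n)"
  shows "c_class n I w = list_monom I (point n w)"
proof -
  obtain u e where w: "w = (u, e)" by (cases w)
  show ?thesis
    using assms unfolding c_class_def list_monom_def length_point
    by (simp add: w act_var_def nth_point prod.atLeast1_atMost_eq)
qed

lemma weyl_B_cases:
  assumes "w \<in> carrier (weyl_B n)"
  obtains u e where "w = (u, e)" "u permutes {1..n}" "\<And>k. e k = 1 \<or> e k = -1" "\<And>k. k \<notin> {1..n} \<Longrightarrow> e k = 1"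
proof (cases w)
  case (Pair u e)
  then have "e k = 1 \<or> e k = -1" for k
    using assms by (cases "k \<in> {1..n}") (auto simp: weyl_B_def)
  then show ?thesis using that[of u e] assms Pair by (auto simp: weyl_B_def)
qed

lemma act_var_mem_signed_indets:
  assumes "w \<in> carrier (weyl_B n)" "k \<in> {1..n}"
  shows "act_var w k \<in> signed_indets n"
proof -
  obtain u e where w: "w = (u, e)" "u permutes {1..n}" "\<And>k. e k = 1 \<or> e k = -1"
    using weyl_B_cases[OF assms(1)] by metis
  have "u k \<in> {1..n}" using permutes_in_image[OF w(2)] assms(2) by simp
  then show ?thesis
    using w(3)[of k] by (auto simp: w(1) act_var_def signed_indets_def)
qed

lemma act_var_neq:
  assumes "w \<in> carrier (weyl_B n)" "k \<noteq> l"
  shows "act_var w k \<noteq> act_var w l" "act_var w k \<noteq> - act_var w l"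
proof -
  obtain u e where w: "w = (u, e)" "u permutes {1..n}" "\<And>k. e k = 1 \<or> e k = -1"
    using weyl_B_cases[OF assms(1)] by metis
  have u: "u k \<noteq> u l" using permutes_inj[OF w(2)] assms(2) by (auto dest: injD)
  show "act_var w k \<noteq> act_var w l"
    using act_var_inj[of "e k" "e l" "u k" "u l"] w(3)[of k] w(3)[of l] u by (auto simp: w(1) act_var_def)
  show "act_var w k \<noteq> - act_var w l"
    using act_var_inj[of "e k" "- e l" "u k" "u l"] w(3)[of k] w(3)[of l] u by (auto simp: w(1) act_var_def)
qed

lemma signed_indets_eq_act_var:
  assumes "w \<in> carrier (weyl_B n)" "x \<in> signed_indets n"
  obtains k where "k \<in> {1..n}" "x = act_var w k \<or> x = - act_var w k"
proof -
  obtain u e where w: "w = (u, e)" "u permutes {1..n}" "\<And>k. e k = 1 \<or> e k = -1"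
    using weyl_B_cases[OF assms(1)] by metis
  obtain i where i: "i \<in> {1..n}" "x = indet i \<or> x = - indet i"
    using assms(2) by (rule signed_indets_cases)
  obtain k where "k \<in> {1..n}" "u k = i"
    using permutes_image[OF w(2)] i(1) by (metis imageE)
  then show ?thesis
    using that[of k] i(2) w(3)[of k] by (auto simp: w(1) act_var_def)
qed

lemma signed_arrangement_point:
  assumes "w \<in> carrier (weyl_B n)"
  shows "signed_arrangement (signed_indets n) (point n w)"
  unfolding signed_arrangement_def
proof
  have set: "set (point n w) = act_var w ` {1..n}"
    by (simp add: point_def atLeastLessThanSuc_atLeastAtMost del: upt_Suc)
  show "signed_indets n = set (point n w) \<union> uminus ` set (point n w)"
  proof (intro Set.equalityI subsetI)
    fix x assume "x \<in> signed_indets n"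
    then obtain k where "k \<in> {1..n}" "x = act_var w k \<or> x = - act_var w k"
      using signed_indets_eq_act_var[OF assms] by metis
    then show "x \<in> set (point n w) \<union> uminus ` set (point n w)"
      unfolding set by blast
  qed (use act_var_mem_signed_indets[OF assms] signed_indets_uminus set in auto)
  show "sorted_wrt (\<lambda>a b. b \<noteq> a \<and> b \<noteq> - a) (point n w)"
    unfolding sorted_wrt_iff_nth_less using act_var_neq[OF assms] by (auto simp: length_point nth_point)
qed

text \<open>Let \<open>i k\<close> be the index underlying the \<open>k\<close>-th entry.
  Distinctness up to sign makes \<open>i\<close> injective, and exhausting all signed indeterminates
  makes it surjective, so it is a permutation; the signs are read off the entries.\<close>

lemma signed_arrangementE:
  assumes "signed_arrangement (signed_indets n) ys"
  obtains w where "w \<in> carrier (weyl_B n)" "ys = point n w"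
proof -
  have V: "signed_indets n = set ys \<union> uminus ` set ys"
    and sorted: "sorted_wrt (\<lambda>a b. b \<noteq> a \<and> b \<noteq> - a) ys"
    using assms by (auto simp: signed_arrangement_def)
  have "\<forall>k\<in>{1..length ys}. \<exists>i. i \<in> {1..n} \<and> (ys ! (k - 1) = indet i \<or> ys ! (k - 1) = - indet i)"
  proof
    fix k assume "k \<in> {1..length ys}"
    then have "ys ! (k - 1) \<in> signed_indets n" using V by auto
    then show "\<exists>i. i \<in> {1..n} \<and> (ys ! (k - 1) = indet i \<or> ys ! (k - 1) = - indet i)"
      using signed_indets_cases by metis
  qed
  from bchoice[OF this] obtain i where
    i: "\<And>k. k \<in> {1..length ys} \<Longrightarrow> i k \<in> {1..n}"
      "\<And>k. k \<in> {1..length ys} \<Longrightarrow> ys ! (k - 1) = indet (i k) \<or> ys ! (k - 1) = - indet (i k)"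
    by blast
  have neq: "i k \<noteq> i l" if "k \<in> {1..length ys}" "l \<in> {1..length ys}" "k < l" for k l
  proof -
    have "k - 1 < l - 1" "l - 1 < length ys" using that by auto
    then have "ys ! (l - 1) \<noteq> ys ! (k - 1)" "ys ! (l - 1) \<noteq> - ys ! (k - 1)"
      using sorted by (auto simp: sorted_wrt_iff_nth_less)
    then show ?thesis using i(2)[OF that(1)] i(2)[OF that(2)] by auto
  qed
  then have inj: "inj_on i {1..length ys}"
    by (intro inj_onI) (metis linorder_neqE_nat)
  have image: "i ` {1..length ys} = {1..n}"
  proof (intro Set.equalityI subsetI)
    fix j assume "j \<in> {1..n}"
    then have "indet j \<in> set ys \<union> uminus ` set ys"
      unfolding V[symmetric] by (auto simp: signed_indets_def)
    then obtain y where y: "y \<in> set ys" "indet j = y \<or> indet j = - y" by blast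
    then obtain k where k: "k < length ys" "ys ! k = y" by (auto simp: in_set_conv_nth)
    then have k': "Suc k \<in> {1..length ys}" by simp
    have "indet j = indet (i (Suc k)) \<or> indet j = - indet (i (Suc k))"
      using i(2)[OF k'] k y by auto
    then have "j = i (Suc k)" by (simp add: indet_eq_iff indet_neq_uminus)
    then show "j \<in> i ` {1..length ys}" using k' by blast
  qed (use i(1) in blast)
  have len: "length ys = n"
    using card_image[OF inj] image by simp
  \<comment> \<open>Outside \<open>{1..n}\<close> the permutation is the identity and the sign is
    \<open>1\<close>, as membership in the carrier demands.\<close>
  define u where "u k = (if k \<in> {1..n} then i k else k)" for k
  define e :: "nat \<Rightarrow> int" where "e k = (if k \<in> {1..n} \<and> ys ! (k - 1) \<noteq> indet (i k) then -1 else 1)" for k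
  have "bij_betw i {1..n} {1..n}"
    using inj image unfolding len bij_betw_def by blast
  then have "bij_betw u {1..n} {1..n}"
    by (subst bij_betw_cong[of _ u i]) (simp_all only: u_def if_True)
  then have "u permutes {1..n}"
    by (rule bij_imp_permutes) (simp only: u_def if_False)
  then have w: "(u, e) \<in> carrier (weyl_B n)"
    by (auto simp: weyl_B_def e_def)
  have "ys = point n (u, e)"
  proof (rule nth_equalityI)
    fix k assume "k < length ys"
    then have k: "Suc k \<in> {1..n}" "k < n" using len by auto
    then show "ys ! k = point n (u, e) ! k"
      using i(2)[of "Suc k"] len by (auto simp: nth_point act_var_def u_def e_def)
  qed (simp add: length_point len)
  then show ?thesis using that w by blast
qed

lemma inj_on_point: "inj_on (point n) (carrier (weyl_B n))"
proof (rule inj_onI)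
  fix w w' assume W: "w \<in> carrier (weyl_B n)" "w' \<in> carrier (weyl_B n)" and eq: "point n w = point n w'"
  obtain u e where w: "w = (u, e)" "u permutes {1..n}" "\<And>k. e k = 1 \<or> e k = -1" "\<And>k. k \<notin> {1..n} \<Longrightarrow> e k = 1"
    using weyl_B_cases[OF W(1)] by metis
  obtain u' e' where w': "w' = (u', e')" "u' permutes {1..n}" "\<And>k. e' k = 1 \<or> e' k = -1" "\<And>k. k \<notin> {1..n} \<Longrightarrow> e' k = 1"
    using weyl_B_cases[OF W(2)] by metis
  have "e k = e' k \<and> u k = u' k" for k
  proof (cases "k \<in> {1..n}")
    case True
    then have "act_var w k = act_var w' k" using eq by (simp add: point_eq_iff)
    then show ?thesis
      using act_var_inj[OF w(3)[of k] w'(3)[of k]] by (simp add: w(1) w'(1) act_var_def)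
  next
    case False
    then show ?thesis using w(4) w'(4) permutes_not_in[OF w(2)] permutes_not_in[OF w'(2)] by simp
  qed
  then show "w = w'" by (auto simp: w(1) w'(1))
qed

section \<open>Right multiplication by a reflection as a signed swap\<close>

lemma indet_mem_linear_forms: "k \<in> {1..n} \<Longrightarrow> indet k \<in> linear_forms n"
proof -
  assume "k \<in> {1..n}"
  then have "indet k = (\<Sum>j=1..n. const_poly (if j = k then 1 else 0) * indet j)"
    by (subst sum.remove[of _ k]) (auto simp: const_poly_simps)
  then show ?thesis unfolding linear_forms_def by fast
qed

text \<open>Apply the ring homomorphism \<open>act w\<close> to the reflection formula for the
  \<open>k\<close>-th indeterminate. In particular corresponding entries of the two points agree
  modulo \<open>act w \<beta>\<close>.\<close>

lemma act_var_mult_reflection: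
  assumes "\<beta> \<in> pos_roots n" "k \<in> {1..n}"
  shows "act_var (w \<otimes>\<^bsub>weyl_B n\<^esub> reflection_elt n \<beta>) k =
    act_var w k - const_poly (2 * form_inner n (indet k) \<beta> / form_inner n \<beta> \<beta>) * act w \<beta>"
proof -
  have "act_var (w \<otimes>\<^bsub>weyl_B n\<^esub> reflection_elt n \<beta>) k = act w (act (reflection_elt n \<beta>) (indet k))"
    using act_mult_indet[where n = n and w = w and v = "reflection_elt n \<beta>" and k = k] by (simp add: act_indet)
  also have "\<dots> = act w (orth_reflection n \<beta> (indet k))"
    using reflection_elt(2)[OF assms(1) indet_mem_linear_forms[OF assms(2)]] by simp
  also have "\<dots> = act_var w k - const_poly (2 * form_inner n (indet k) \<beta> / form_inner n \<beta> \<beta>) * act w \<beta>"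
    unfolding orth_reflection_def act_eq_poly_subst poly_subst_diff poly_subst_mult
      poly_subst_const poly_subst_indet ..
  finally show ?thesis .
qed

lemma reflection_mult_closed:
  "w \<in> carrier (weyl_B n) \<Longrightarrow> \<beta> \<in> pos_roots n \<Longrightarrow>
    w \<otimes>\<^bsub>weyl_B n\<^esub> reflection_elt n \<beta> \<in> carrier (weyl_B n)"
  using group_weyl_B reflection_elt(1) by (meson group.is_monoid monoid.m_closed)

lemma signed_swap_commute: "signed_swap a b = signed_swap b a"
  by (auto simp: signed_swap_def fun_eq_iff)

text \<open>Write \<open>x\<close> and \<open>y\<close> as signed entries of the point at positions
  \<open>i\<close> and \<open>j\<close>. Equal signs lead to the root
  \<open>indet i - indet j\<close>, opposite signs to \<open>indet i + indet j\<close>, and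
  \<open>i = j\<close> forces \<open>y = - x\<close> and leads to \<open>indet i\<close>.\<close>

lemma map_signed_swap_point:
  assumes w: "w \<in> carrier (weyl_B n)"
    and xy: "x \<in> signed_indets n" "y \<in> signed_indets n" "x \<noteq> y"
  shows "\<exists>\<beta>\<in>pos_roots n. x - y dvd act w \<beta> \<and>
    map (signed_swap x y) (point n w) = point n (w \<otimes>\<^bsub>weyl_B n\<^esub> reflection_elt n \<beta>)"
    (is "\<exists>\<beta>\<in>_. ?P x y \<beta>")
proof -
  let ?Y = "act_var w"
  have self: "?Y k \<noteq> - ?Y k" if "k \<in> {1..n}" for k
    using signed_indets_neq_uminus[OF act_var_mem_signed_indets[OF w that]] by simp
  note neq = act_var_neq[OF w]
  have mapI: "map (signed_swap x y) (point n w) = point n (w \<otimes>\<^bsub>weyl_B n\<^esub> reflection_elt n \<beta>)"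
    if "\<And>k. k \<in> {1..n} \<Longrightarrow> act_var (w \<otimes>\<^bsub>weyl_B n\<^esub> reflection_elt n \<beta>) k = signed_swap x y (?Y k)"
    for \<beta> x y
    using that by (auto simp: point_def simp del: upt_Suc)
  have act_plus: "act w (p + q) = act w p + act w q" and act_diff: "act w (p - q) = act w p - act w q" for p q
    by (simp_all add: act_eq_poly_subst poly_subst_add poly_subst_diff)
  have same: "\<exists>\<beta>\<in>pos_roots n. ?P x (- x) \<beta>"
    if i: "i \<in> {1..n}" and x: "x = ?Y i \<or> x = - ?Y i" for x i
  proof (intro bexI conjI mapI)
    show \<beta>: "indet i \<in> pos_roots n" using i by (auto simp: pos_roots_def)
    show "x - - x dvd act w (indet i)"
      using x diff_uminus_dvd[of x] by (auto simp: act_indet)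
    fix k assume k: "k \<in> {1..n}"
    have two: "const_poly 2 = 2"
      using const_poly_simps(6)[of 2] by simp
    have "act_var (w \<otimes>\<^bsub>weyl_B n\<^esub> reflection_elt n (indet i)) k = (if k = i then - ?Y i else ?Y k)"
      by (simp add: act_var_mult_reflection[OF \<beta> k] form_inner_indet[OF i] const_poly_simps(3) two act_indet)
    moreover have "signed_swap x (- x) (?Y k) = (if k = i then - ?Y i else ?Y k)"
      using x
    proof
      assume "x = ?Y i"
      then show ?thesis using neq[of k i] by (cases "k = i") (simp_all add: signed_swap_def)
    next
      assume "x = - ?Y i"
      then show ?thesis using neq[of k i] self[OF i] by (cases "k = i") (simp_all add: signed_swap_def)
    qed
    ultimately show "act_var (w \<otimes>\<^bsub>weyl_B n\<^esub> reflection_elt n (indet i)) k = signed_swap x (- x) (?Y k)"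
      by simp
  qed
  \<comment> \<open>Positive roots require \<open>i < j\<close>; the other order follows because the
    swap is symmetric in \<open>x\<close> and \<open>y\<close>.\<close>
  have less: "\<exists>\<beta>\<in>pos_roots n. ?P x y \<beta>"
    if i: "i \<in> {1..n}" "x = ?Y i \<or> x = - ?Y i" and j: "j \<in> {1..n}" "y = ?Y j \<or> y = - ?Y j" and "i < j"
    for x y i j
  proof (cases "(x = ?Y i) = (y = ?Y j)")
    case True
    then have x: "x = ?Y i \<and> y = ?Y j \<or> x = - ?Y i \<and> y = - ?Y j" using i j by auto
    let ?\<beta> = "indet i - indet j"
    have \<beta>: "?\<beta> \<in> pos_roots n" using i(1) j(1) \<open>i < j\<close> by (auto simp: pos_roots_def)
    have "- ?Y i - - ?Y j dvd - (- ?Y i - - ?Y j)" by (simp only: dvd_minus_iff dvd_refl)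
    then have dvd: "x - y dvd act w ?\<beta>"
      using x by (auto simp: act_diff act_indet)
    show ?thesis
    proof (intro bexI[OF _ \<beta>] conjI dvd mapI)
      fix k assume k: "k \<in> {1..n}"
      show "act_var (w \<otimes>\<^bsub>weyl_B n\<^esub> reflection_elt n ?\<beta>) k = signed_swap x y (?Y k)"
      proof -
        have "act_var (w \<otimes>\<^bsub>weyl_B n\<^esub> reflection_elt n ?\<beta>) k = (if k = i then ?Y j else if k = j then ?Y i else ?Y k)"
          using \<open>i < j\<close> by (simp add: act_var_mult_reflection[OF \<beta> k] form_inner_add form_inner_indet[OF i(1)]
            form_inner_indet[OF j(1)] const_poly_simps act_diff act_indet)
        moreover have "signed_swap x y (?Y k) = (if k = i then ?Y j else if k = j then ?Y i else ?Y k)"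
          using x
        proof
          assume "x = ?Y i \<and> y = ?Y j"
          then show ?thesis
            using neq[of k i] neq[of k j] by (cases "k = i"; cases "k = j") (simp_all add: signed_swap_def)
        next
          assume "x = - ?Y i \<and> y = - ?Y j"
          then show ?thesis
            using neq[of k i] neq[of k j] neq[of i j] neq[of j i] self[OF i(1)] self[OF j(1)]
            by (cases "k = i"; cases "k = j") (simp_all add: signed_swap_def)
        qed
        ultimately show ?thesis by simp
      qed
    qed
  next
    case False
    then have x: "x = ?Y i \<and> y = - ?Y j \<or> x = - ?Y i \<and> y = ?Y j" using i j by auto
    let ?\<beta> = "indet i + indet j"
    have \<beta>: "?\<beta> \<in> pos_roots n" using i(1) j(1) \<open>i < j\<close> by (auto simp: pos_roots_def)
    have "- ?Y i - ?Y j dvd - (- ?Y i - ?Y j)" by (simp only: dvd_minus_iff dvd_refl)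
    then have dvd: "x - y dvd act w ?\<beta>"
      using x by (auto simp: act_plus act_indet add.commute)
    show ?thesis
    proof (intro bexI[OF _ \<beta>] conjI dvd mapI)
      fix k assume k: "k \<in> {1..n}"
      show "act_var (w \<otimes>\<^bsub>weyl_B n\<^esub> reflection_elt n ?\<beta>) k = signed_swap x y (?Y k)"
      proof -
        have "act_var (w \<otimes>\<^bsub>weyl_B n\<^esub> reflection_elt n ?\<beta>) k = (if k = i then - ?Y j else if k = j then - ?Y i else ?Y k)"
          using \<open>i < j\<close> by (simp add: act_var_mult_reflection[OF \<beta> k] form_inner_add form_inner_indet[OF i(1)]
            form_inner_indet[OF j(1)] const_poly_simps act_plus act_indet)
        moreover have "signed_swap x y (?Y k) = (if k = i then - ?Y j else if k = j then - ?Y i else ?Y k)"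
          using x
        proof
          assume "x = ?Y i \<and> y = - ?Y j"
          then show ?thesis
            using neq[of k i] neq[of k j] neq[of i j] neq[of j i] self[OF i(1)] self[OF j(1)]
            by (cases "k = i"; cases "k = j") (simp_all add: signed_swap_def)
        next
          assume "x = - ?Y i \<and> y = ?Y j"
          then show ?thesis
            using neq[of k i] neq[of k j] neq[of i j] neq[of j i] self[OF i(1)] self[OF j(1)]
            by (cases "k = i"; cases "k = j") (simp_all add: signed_swap_def)
        qed
        ultimately show ?thesis by simp
      qed
    qed
  qed
  obtain i where i: "i \<in> {1..n}" "x = ?Y i \<or> x = - ?Y i"
    using signed_indets_eq_act_var[OF w xy(1)] by metis
  obtain j where j: "j \<in> {1..n}" "y = ?Y j \<or> y = - ?Y j"
    using signed_indets_eq_act_var[OF w xy(2)] by metis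
  consider "i = j" | "i < j" | "j < i" by linarith
  then show ?thesis
  proof cases
    case 1
    then have "y = - x" using i j xy(3) by auto
    then show ?thesis using same[OF i] by simp
  next
    case 2
    then show ?thesis using less[OF i j] by simp
  next
    case 3
    then obtain \<beta> where "\<beta> \<in> pos_roots n" "?P y x \<beta>" using less[OF j i] by blast
    moreover have "x - y dvd a \<longleftrightarrow> y - x dvd a" for a
      by (metis minus_diff_eq minus_dvd_iff)
    ultimately show ?thesis unfolding signed_swap_commute[of x y] by blast
  qed
qed

section \<open>The module of classes\<close>

lemma act_var_closed:
  assumes "w \<in> carrier (weyl_B n)" "k \<in> {1..n}"
  shows "act_var w k \<in> carrier (poly_ring n)"
  using act_var_mem_signed_indets[OF assms]
  by (auto simp: signed_indets_def intro!: poly_ring_closed poly_ring_closed_more)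

lemma act_pos_root_closed:
  assumes "w \<in> carrier (weyl_B n)" "\<beta> \<in> pos_roots n"
  shows "act w \<beta> \<in> carrier (poly_ring n)"
proof -
  have diff: "p - q \<in> carrier (poly_ring n)"
    if "p \<in> carrier (poly_ring n)" "q \<in> carrier (poly_ring n)" for p q
    using poly_ring_closed(4)[OF that(1) poly_ring_closed(3)[OF that(2)]] by simp
  show ?thesis
    using assms(2) act_var_closed[OF assms(1)]
    by (auto simp: pos_roots_def act_eq_poly_subst poly_subst_add poly_subst_diff poly_subst_indet
        intro!: diff poly_ring_closed)
qed

lemma c_class_closed:
  assumes "w \<in> carrier (weyl_B n)"
  shows "c_class n I w \<in> carrier (poly_ring n)"
  unfolding c_class_eq_list_monom[OF assms] list_monom_def length_point
  by (intro poly_ring_closed_more) (simp add: nth_point act_var_closed[OF assms])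

text \<open>The points of \<open>w\<close> and of its product with the reflection agree entrywise
  modulo \<open>act w \<beta>\<close>, hence so do their monomials; the quotient can be taken inside
  \<open>poly_ring n\<close>.\<close>

lemma c_class_mem_H_alpha: "c_class n I \<in> carrier (H_alpha n)"
  unfolding mem_H_alpha
proof (intro conjI ballI)
  show "c_class n I \<in> carrier (weyl_B n) \<rightarrow>\<^sub>E carrier (poly_ring n)"
  proof (rule PiE_I)
    show "c_class n I w = undefined" if "w \<notin> carrier (weyl_B n)" for w
      using that unfolding c_class_def by simp
  qed (rule c_class_closed)
  fix w \<beta> assume w: "w \<in> carrier (weyl_B n)" and \<beta>: "\<beta> \<in> pos_roots n"
  let ?v = "w \<otimes>\<^bsub>weyl_B n\<^esub> reflection_elt n \<beta>"
  have v: "?v \<in> carrier (weyl_B n)" using reflection_mult_closed[OF w \<beta>] .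
  have "c_class n I ?v - c_class n I w \<in> carrier (poly_ring n)"
    using poly_ring_closed(4)[OF c_class_closed[OF v] poly_ring_closed(3)[OF c_class_closed[OF w]]] by simp
  moreover have "act w \<beta> dvd c_class n I ?v - c_class n I w"
    unfolding c_class_eq_list_monom[OF v] c_class_eq_list_monom[OF w]
    by (rule dvd_list_monom_diff) (simp_all add: length_point nth_point act_var_mult_reflection[OF \<beta>])
  ultimately show "\<exists>q\<in>carrier (poly_ring n). c_class n I ?v - c_class n I w = q * act w \<beta>"
    using dvd_in_poly_ring act_pos_root_closed[OF w \<beta>] by blast
qed

text \<open>The inverse of \<open>w\<close> acts by a ring homomorphism and carries each entry of
  the point of \<open>w v\<close> to the corresponding entry of the point of
  \<open>v\<close>.\<close>

lemma W_invariant_c_class: "W_invariant n (c_class n I)"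
  unfolding W_invariant_def
proof
  fix w assume w: "w \<in> carrier (weyl_B n)"
  interpret group "weyl_B n" by (rule group_weyl_B)
  show "act_class n w (c_class n I) = c_class n I"
  proof
    fix v
    show "act_class n w (c_class n I) v = c_class n I v"
    proof (cases "v \<in> carrier (weyl_B n)")
      case True
      have "act (inv\<^bsub>weyl_B n\<^esub> w) (act_var (w \<otimes>\<^bsub>weyl_B n\<^esub> v) k) = act_var v k" for k
      proof -
        have "act (inv\<^bsub>weyl_B n\<^esub> w) (act (w \<otimes>\<^bsub>weyl_B n\<^esub> v) (indet k)) =
          act (inv\<^bsub>weyl_B n\<^esub> w \<otimes>\<^bsub>weyl_B n\<^esub> (w \<otimes>\<^bsub>weyl_B n\<^esub> v)) (indet k)"
          by (simp only: act_mult_indet)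
        also have "inv\<^bsub>weyl_B n\<^esub> w \<otimes>\<^bsub>weyl_B n\<^esub> (w \<otimes>\<^bsub>weyl_B n\<^esub> v) = v"
          using w True by (simp add: m_assoc[symmetric])
        finally show ?thesis by (simp add: act_indet)
      qed
      then have "act (inv\<^bsub>weyl_B n\<^esub> w) (list_monom I (point n (w \<otimes>\<^bsub>weyl_B n\<^esub> v))) = list_monom I (point n v)"
        unfolding list_monom_def length_point act_eq_poly_subst poly_subst_prod poly_subst_power
        by (simp add: nth_point)
      then show ?thesis
        using w True by (simp add: act_class_def c_class_eq_list_monom)
    qed (simp add: act_class_def c_class_def)
  qed
qed

section \<open>Linear independence\<close>

text \<open>The case \<open>d = 0\<close> of independence modulo \<open>d\<close>: being divisible
  by \<open>0\<close> means vanishing, and nonzero differences are regular because the polynomials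
  form an integral domain.\<close>

lemma c_class_coefficients_eq_0:
  assumes "\<And>w. w \<in> carrier (weyl_B n) \<Longrightarrow> (\<Sum>I\<in>index_set n. b I * c_class n I w) = 0" "I \<in> index_set n"
  shows "b I = 0"
proof -
  have "0 dvd b I"
  proof (rule dvd_coefficients_of_dvd_sums[OF sign_symmetric_signed_indets card_signed_indets _ _ assms(2)])
    show "regular_mod 0 (x - y)" if "x \<noteq> y" for x y :: rpoly
      using that by (simp add: regular_mod_def)
    fix ys assume "signed_arrangement (signed_indets n) ys"
    then obtain w where "w \<in> carrier (weyl_B n)" "ys = point n w"
      by (rule signed_arrangementE)
    then show "0 dvd (\<Sum>I\<in>index_set n. b I * list_monom I ys)"
      using assms(1)[of w] by (simp add: c_class_eq_list_monom)
  qed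
  then show ?thesis by simp
qed

lemma inj_on_c_class: "inj_on (c_class n) (index_set n)"
proof (rule inj_onI, rule ccontr)
  fix I J assume IJ: "I \<in> index_set n" "J \<in> index_set n" "c_class n I = c_class n J" "I \<noteq> J"
  \<comment> \<open>Two equal classes would satisfy a relation with coefficients \<open>1\<close>
    and \<open>- 1\<close>.\<close>
  define b :: "nat list \<Rightarrow> rpoly" where "b K = (if K = I then 1 else if K = J then - 1 else 0)" for K
  have "(\<Sum>K\<in>index_set n. b K * c_class n K w) = 0" for w
  proof -
    have "(\<Sum>K\<in>index_set n. b K * c_class n K w) = (\<Sum>K\<in>{I, J}. b K * c_class n K w)"
      using IJ finite_index_set by (intro sum.mono_neutral_right) (auto simp: b_def)
    then show ?thesis using IJ by (simp add: b_def)
  qed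
  then have "b I = 0" using IJ(1) c_class_coefficients_eq_0[of n b I] by blast
  then show False by (simp add: b_def)
qed

section \<open>Spanning\<close>

text \<open>Transport \<open>f\<close> to arrangements along the bijection \<open>point n\<close>,
  expand it there with coefficients in the ambient ring, and truncate these coefficients.\<close>

lemma H_alpha_eq_sum_c_class:
  assumes f: "f \<in> carrier (H_alpha n)"
  shows "\<exists>b. (\<forall>I. b I \<in> carrier (poly_ring n)) \<and>
    (\<forall>w\<in>carrier (weyl_B n). f w = (\<Sum>I\<in>index_set n. b I * c_class n I w))"
proof -
  define F where "F ys = f (inv_into (carrier (weyl_B n)) (point n) ys)" for ys
  have F: "F (point n w) = f w" if "w \<in> carrier (weyl_B n)" for w
    using that by (simp add: F_def inv_into_f_f[OF inj_on_point])
  have "\<exists>b. \<forall>ys. signed_arrangement (signed_indets n) ys \<longrightarrow> F ys = (\<Sum>I\<in>index_set n. b I * list_monom I ys)"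
  proof (rule gkm_function_eq_sum[OF sign_symmetric_signed_indets card_signed_indets])
    show "regular_mod (x - y) (x - z)"
      if "x \<in> signed_indets n" "y \<in> signed_indets n" "z \<in> signed_indets n" "x \<noteq> y" "x \<noteq> z" "y \<noteq> z" for x y z
    proof (rule regular_mod_signed_indets[OF that(1,2,1,3)])
      \<comment> \<open>Equality would force \<open>z = - x\<close> and \<open>x = - y\<close>,
        hence \<open>z = y\<close>, since \<open>x\<close> is not its own negative.\<close>
      show "{x, z} \<noteq> {- x, - y}"
        using that signed_indets_neq_uminus[OF that(1)] by (auto simp: doubleton_eq_iff)
    qed (use that in \<open>auto simp: doubleton_eq_iff\<close>)
    show "regular_mod (x - y) (v - w)"
      if "x \<in> signed_indets n" "y \<in> signed_indets n" "x \<noteq> y"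
        "v \<in> signed_indets n - {x, - x}" "w \<in> signed_indets n - {x, - x}" "v \<noteq> w" for x y v w
      using that by (intro regular_mod_signed_indets[of _ n]) (auto simp: doubleton_eq_iff)
    fix ys x y
    assume ys: "signed_arrangement (signed_indets n) ys"
      and xy: "x \<in> signed_indets n" "y \<in> signed_indets n" "x \<noteq> y"
    obtain w where w: "w \<in> carrier (weyl_B n)" "ys = point n w"
      using ys by (rule signed_arrangementE)
    obtain \<beta> where \<beta>: "\<beta> \<in> pos_roots n" "x - y dvd act w \<beta>"
      "map (signed_swap x y) ys = point n (w \<otimes>\<^bsub>weyl_B n\<^esub> reflection_elt n \<beta>)"
      using map_signed_swap_point[OF w(1) xy] w(2) by blast
    have "act w \<beta> dvd f (w \<otimes>\<^bsub>weyl_B n\<^esub> reflection_elt n \<beta>) - f w"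
      using f w(1) \<beta>(1) unfolding mem_H_alpha by (metis dvd_triv_right)
    then show "x - y dvd F (map (signed_swap x y) ys) - F ys"
      using \<beta>(2) unfolding \<beta>(3) F[OF reflection_mult_closed[OF w(1) \<beta>(1)]] unfolding w(2) F[OF w(1)]
      by (rule dvd_trans[rotated])
  qed
  then obtain b where b: "\<And>ys. signed_arrangement (signed_indets n) ys \<Longrightarrow>
    F ys = (\<Sum>I\<in>index_set n. b I * list_monom I ys)" by blast
  show ?thesis
  proof (intro exI[of _ "\<lambda>I. truncate_indets n (b I)"] conjI allI ballI)
    show "truncate_indets n (b I) \<in> carrier (poly_ring n)" for I
      by (rule truncate_indets_closed)
    fix w assume w: "w \<in> carrier (weyl_B n)"
    have "f w \<in> carrier (poly_ring n)" using f w by (auto simp: mem_H_alpha)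
    moreover have "f w = (\<Sum>I\<in>index_set n. b I * c_class n I w)"
      using b[OF signed_arrangement_point[OF w]] by (simp add: F[OF w] c_class_eq_list_monom[OF w])
    ultimately have "f w = truncate_indets n (\<Sum>I\<in>index_set n. b I * c_class n I w)"
      by (simp add: truncate_indets_id)
    \<comment> \<open>Truncation is a ring homomorphism that fixes the values of the classes, so
      only the coefficients change.\<close>
    also have "\<dots> =
      (\<Sum>I\<in>index_set n. truncate_indets n (b I) * truncate_indets n (c_class n I w))"
      by (simp add: truncate_indets_def poly_subst_sum poly_subst_mult)
    also have "\<dots> = (\<Sum>I\<in>index_set n. truncate_indets n (b I) * c_class n I w)"
      by (simp add: truncate_indets_id c_class_closed[OF w])
    finally show "f w = (\<Sum>I\<in>index_set n. truncate_indets n (b I) * c_class n I w)" .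
  qed
qed

section \<open>Linear combinations in the module and the basis property\<close>

lemma module_H_alpha: "Module.module (poly_ring n) (H_alpha n)"
  by (rule algebra.axioms(1)[OF algebra_H_alpha])

lemma lincomb_H_alpha:
  assumes "finite A" "A \<subseteq> carrier (H_alpha n)" "a \<in> A \<rightarrow> carrier (poly_ring n)" "w \<in> carrier (weyl_B n)"
  shows "module.lincomb (H_alpha n) a A w = (\<Sum>v\<in>A. a v * v w)"
proof -
  interpret module "poly_ring n" "H_alpha n" by (rule module_H_alpha)
  have add: "(f \<oplus>\<^bsub>H_alpha n\<^esub> g) w = f w + g w" for f g
    using assms(4) by (simp add: H_alpha_def)
  have smult: "(r \<odot>\<^bsub>H_alpha n\<^esub> f) w = r * f w" for r f
    using assms(4) by (simp add: H_alpha_def)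
  have zero: "\<zero>\<^bsub>H_alpha n\<^esub> w = 0"
    using assms(4) by (simp add: H_alpha_def)
  show ?thesis
    using assms(1-3) unfolding lincomb_def
  proof (induction A rule: finite_induct)
    case empty
    then show ?case by (simp add: zero)
  next
    case (insert v A)
    have "(\<Oplus>\<^bsub>H_alpha n\<^esub>v\<in>insert v A. a v \<odot>\<^bsub>H_alpha n\<^esub> v) =
      a v \<odot>\<^bsub>H_alpha n\<^esub> v \<oplus>\<^bsub>H_alpha n\<^esub> (\<Oplus>\<^bsub>H_alpha n\<^esub>v\<in>A. a v \<odot>\<^bsub>H_alpha n\<^esub> v)"
      using insert.hyps insert.prems by (intro M.finsum_insert) auto
    then show ?case
      using insert by (simp add: add smult)
  qed
qed

lemma module_basis_c_class: "module_basis (poly_ring n) (H_alpha n) (c_class n ` index_set n)"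
proof -
  interpret module "poly_ring n" "H_alpha n" by (rule module_H_alpha)
  let ?C = "c_class n ` index_set n"
  have fin: "finite ?C" and sub: "?C \<subseteq> carrier (H_alpha n)"
    using finite_index_set c_class_mem_H_alpha by auto
  have lincomb: "lincomb a ?C w = (\<Sum>I\<in>index_set n. a (c_class n I) * c_class n I w)"
    if "a \<in> ?C \<rightarrow> carrier (poly_ring n)" "w \<in> carrier (weyl_B n)" for a w
    using lincomb_H_alpha[OF fin sub that] by (simp add: sum.reindex[OF inj_on_c_class])
  have "\<not> lin_dep ?C"
  proof
    assume "lin_dep ?C"
    then obtain a v where a: "a \<in> ?C \<rightarrow> carrier (poly_ring n)" "lincomb a ?C = \<zero>\<^bsub>H_alpha n\<^esub>"
      "v \<in> ?C" "a v \<noteq> \<zero>\<^bsub>poly_ring n\<^esub>"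
      using finite_lin_dep[OF fin _ sub] by blast
    from a(3) obtain I where I: "I \<in> index_set n" "v = c_class n I" by blast
    have "a (c_class n I) = 0"
    proof (rule c_class_coefficients_eq_0[of n "\<lambda>I. a (c_class n I)"])
      fix w assume "w \<in> carrier (weyl_B n)"
      then show "(\<Sum>I\<in>index_set n. a (c_class n I) * c_class n I w) = 0"
        using lincomb[OF a(1), of w] a(2) by (simp add: H_alpha_def)
    qed (rule I(1))
    then show False using a(4) I(2) by (simp add: poly_ring_def)
  qed
  moreover have "span ?C = carrier (H_alpha n)"
  proof
    show "span ?C \<subseteq> carrier (H_alpha n)"
      using sub unfolding span_def by (auto intro!: lincomb_closed)
    show "carrier (H_alpha n) \<subseteq> span ?C"
    proof
      fix f assume f: "f \<in> carrier (H_alpha n)"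
      obtain b where b: "\<And>I. b I \<in> carrier (poly_ring n)"
        "\<And>w. w \<in> carrier (weyl_B n) \<Longrightarrow> f w = (\<Sum>I\<in>index_set n. b I * c_class n I w)"
        using H_alpha_eq_sum_c_class[OF f] by blast
      \<comment> \<open>Linear combinations are indexed by the classes themselves; injectivity of
        \<open>c_class n\<close> on \<open>index_set n\<close> transfers the coefficients from
        exponent lists to classes.\<close>
      define a where "a v = b (inv_into (index_set n) (c_class n) v)" for v
      have a: "a \<in> ?C \<rightarrow> carrier (poly_ring n)" using b(1) by (simp add: a_def)
      have "f w = lincomb a ?C w" for w
      proof (cases "w \<in> carrier (weyl_B n)")
        case True
        then show ?thesis
          using lincomb[OF a True] b(2)[OF True] by (simp add: a_def inv_into_f_f[OF inj_on_c_class])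
      next
        case False
        \<comment> \<open>Elements of the module are extensional, so off the carrier of
          \<open>W\<close> both sides take the same default value.\<close>
        have "g w = undefined" if "g \<in> carrier (H_alpha n)" for g
          using that False PiE_arb[of g "carrier (weyl_B n)" "\<lambda>_. carrier (poly_ring n)" w]
          by (simp add: mem_H_alpha)
        then show ?thesis
          using f lincomb_closed[OF sub a] by metis
      qed
      then have "f = lincomb a ?C" by blast
      then show "f \<in> span ?C" using fin a unfolding span_def by blast
    qed
  qed
  ultimately show ?thesis
    unfolding module_basis_def using module_H_alpha sub by blast
qed

theorem mainTheorem8:
  fixes n :: nat
  assumes "n \<ge> 2"
  shows "inj_on (c_class n) (index_set n)
    \<and> module_basis (poly_ring n) (H_alpha n) (c_class n ` index_set n)
    \<and> (\<forall>I\<in>index_set n. W_invariant n (c_class n I))"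
  using inj_on_c_class module_basis_c_class W_invariant_c_class by blast

end
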